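(* Let $\boldsymbol Y\in\mathbb{R}^{d_Y}$, $\boldsymbol X\in\mathbb{R}^{d_X}$, $\boldsymbol Z\in\mathbb{R}^{d_Z}$ be random vectors on a common probability space, and let $$T^{\mathrm{AC,cond}}:=\frac{\int \mathbb{E}\big(\mathrm{var}(\mathbb{P}(\boldsymbol Y\ge \boldsymbol y\mid \boldsymbol Z,\boldsymbol X)\mid \boldsymbol X)\big)\,d\tilde\mu_{\boldsymbol Y}(\boldsymbol y)}{\int \mathbb{E}\big(\mathrm{var}(\mathbb{1}\{\boldsymbol Y\ge \boldsymbol y\}\mid \boldsymbol X)\big)\,d\tilde\mu_{\boldsymbol Y}(\boldsymbol y)}.$$ Suppose that $\boldsymbol Y$ is not almost surely a function of $\boldsymbol X$. Then: (i) $T^{\mathrm{AC,cond}}\in[0,1]$; (ii) $T^{\mathrm{AC,cond}}=0$ if and only if $\boldsymbol Y$ and $\boldsymbol Z$ are conditionally independent given $\boldsymbol X$; (iii) $T^{\mathrm{AC,cond}}=1$ if and only if $\boldsymbol Y$ is almost surely a function of $(\boldsymbol X,\boldsymbol Z)$.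
   Context: For vectors $\boldsymbol a,\boldsymbol b\in\mathbb{R}^d$, $\boldsymbol a\le\boldsymbol b$ (equivalently $\boldsymbol b\ge\boldsymbol a$) means $\boldsymbol a_i\le \boldsymbol b_i$ for all $i$. $\tilde\mu_{\boldsymbol Y}$ denotes the probability measure on $\mathbb{R}^{d_Y}$ which is the product of the one-dimensional marginal distributions of the coordinates of $\boldsymbol Y$. *)

theory Defs
  imports "HOL-Probability.Probability"
begin

definition sigma_gen :: "'a measure \<Rightarrow> ('a \<Rightarrow> 'b::topological_space) \<Rightarrow> 'a measure" where
  "sigma_gen M X = vimage_algebra (space M) X borel"

definition cond_expectation :: "'a measure \<Rightarrow> ('a \<Rightarrow> 'b::topological_space) \<Rightarrow> ('a \<Rightarrow> real) \<Rightarrow> 'a \<Rightarrow> real" where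
  "cond_expectation M X W = real_cond_exp M (sigma_gen M X) W"

definition cond_probability :: "'a measure \<Rightarrow> ('a \<Rightarrow> 'b::topological_space) \<Rightarrow> 'a set \<Rightarrow> 'a \<Rightarrow> real" where
  "cond_probability M X A = cond_expectation M X (indicat_real A)"

definition cond_variance :: "'a measure \<Rightarrow> ('a \<Rightarrow> 'b::topological_space) \<Rightarrow> ('a \<Rightarrow> real) \<Rightarrow> 'a \<Rightarrow> real" where
  "cond_variance M X W = cond_expectation M X (\<lambda>\<omega>. (W \<omega> - cond_expectation M X W \<omega>)\<^sup>2)"

definition cond_indep ::
  "'a measure \<Rightarrow> ('a \<Rightarrow> 'b::topological_space) \<Rightarrow> ('a \<Rightarrow> 'c::topological_space) \<Rightarrow>
    ('a \<Rightarrow> 'd::topological_space) \<Rightarrow> bool" where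
  "cond_indep M Y Z X \<longleftrightarrow>
    (\<forall>A\<in>sets borel. \<forall>B\<in>sets borel. AE \<omega> in M.
      cond_probability M X {\<omega>\<in>space M. Y \<omega> \<in> A \<and> Z \<omega> \<in> B} \<omega> =
      cond_probability M X {\<omega>\<in>space M. Y \<omega> \<in> A} \<omega> * cond_probability M X {\<omega>\<in>space M. Z \<omega> \<in> B} \<omega>)"

definition ae_function_of ::
  "'a measure \<Rightarrow> ('a \<Rightarrow> 'b::topological_space) \<Rightarrow> ('a \<Rightarrow> 'c::topological_space) \<Rightarrow> bool" where
  "ae_function_of M Y X \<longleftrightarrow> (\<exists>f\<in>borel_measurable borel. AE \<omega> in M. Y \<omega> = f (X \<omega>))"

(* PiM lives on functions 'd => real; vec_lambda transports the product measure to real^'d. *)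
definition product_of_marginals :: "'a measure \<Rightarrow> ('a \<Rightarrow> real^'d) \<Rightarrow> (real^'d) measure" where
  "product_of_marginals M Y =
    distr (\<Pi>\<^sub>M i\<in>UNIV. distr M borel (\<lambda>\<omega>. Y \<omega> $ i)) borel vec_lambda"

(* The order on real^'d is the componentwise one. Both integrands are functions of y alone that
   do not depend on the versions of the conditional expectations chosen for each y. *)
definition T_AC_cond ::
  "'a measure \<Rightarrow> ('a \<Rightarrow> real^'dY) \<Rightarrow> ('a \<Rightarrow> real^'dX) \<Rightarrow> ('a \<Rightarrow> real^'dZ) \<Rightarrow> real" where
  "T_AC_cond M Y X Z =
    (\<integral>y. (\<integral>\<omega>. cond_variance M X
        (cond_probability M (\<lambda>\<omega>. (Z \<omega>, X \<omega>)) {\<omega>\<in>space M. Y \<omega> \<ge> y}) \<omega> \<partial>M)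
      \<partial>product_of_marginals M Y) /
    (\<integral>y. (\<integral>\<omega>. cond_variance M X
        (indicat_real {\<omega>\<in>space M. Y \<omega> \<ge> y}) \<omega> \<partial>M)
      \<partial>product_of_marginals M Y)"

end

theory Submission
  imports Defs
begin

text \<open>
  For a point \<open>y\<close> and a sigma-algebra \<open>F\<close> let \<open>e F y\<close> be the expectation of the squared conditional probability
  \<open>P(y \<le> Y | F)\<^sup>2\<close>. An expected conditional variance is a difference of two such energies: the
  numerator integrates \<open>e (Z,X) y - e X y\<close> and the denominator integrates \<open>e M y - e X y\<close>, where
  \<open>M\<close> is the full sigma-algebra. The denominator therefore exceeds the numerator by the integral of
  \<open>e M y - e (Z,X) y\<close>. For nested sigma-algebras \<open>F \<subseteq> G\<close> the Pythagorean identity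
  (\<open>cond_exp_pythagoras\<close>) turns \<open>e G y - e F y\<close> into the expectation of
  \<open>(P(y \<le> Y | G) - P(y \<le> Y | F))\<^sup>2\<close>. Hence all three integrals are nonnegative, which puts the
  quotient into the unit interval as soon as the denominator is nonzero.

  The main point (\<open>integrated_energy_gap\<close>) is that such an integral vanishes only if
  \<open>P(Y \<in> A | G) = P(Y \<in> A | F)\<close> almost surely for every Borel set \<open>A\<close>. Vanishing gives this for
  the orthants at almost all \<open>y\<close>, with respect to the product of the marginals of \<open>Y\<close>. Every
  orthant without a null side is an almost sure limit of orthants from a prescribed set of full
  measure (\<open>orthant_ae_limit\<close>), conditional expectations are continuous in L1, and orthants generate
  the Borel sets.

  It remains to read off the meaning of equal conditional laws. Given \<open>F\<close> generated by \<open>W\<close> and the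
  full sigma-algebra, it means that \<open>Y\<close> is almost surely a function of \<open>W\<close>
  (\<open>ae_function_of_iff_same_cond_law\<close>); with \<open>W = X\<close> this makes the denominator positive, and with
  \<open>W = (Z, X)\<close> it describes when the quotient is one. Given the sigma-algebras of \<open>X\<close> and of
  \<open>(Z, X)\<close>, it is conditional independence (\<open>cond_indep_iff_same_cond_law\<close>), which describes when
  the quotient is zero.
\<close>

section \<open>Bounded conditional expectations\<close>

text \<open>
  Apply monotonicity of conditional expectation to both \<open>f \<le> \<bar>f\<bar>\<close> and \<open>- f \<le> \<bar>f\<bar>\<close> and integrate.
\<close>

lemma (in sigma_finite_subalgebra) real_cond_exp_L1_contraction:
  assumes "integrable M f"
  shows "(\<integral>x. \<bar>real_cond_exp M F f x\<bar> \<partial>M) \<le> (\<integral>x. \<bar>f x\<bar> \<partial>M)"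
proof -
  have abs_int: "integrable M (\<lambda>x. \<bar>f x\<bar>)" and neg_int: "integrable M (\<lambda>x. - f x)"
    using assms by auto
  have "AE x in M. real_cond_exp M F f x \<le> real_cond_exp M F (\<lambda>x. \<bar>f x\<bar>) x"
    by (rule real_cond_exp_mono) (use assms abs_int in auto)
  moreover have "AE x in M. real_cond_exp M F (\<lambda>x. - f x) x \<le> real_cond_exp M F (\<lambda>x. \<bar>f x\<bar>) x"
    by (rule real_cond_exp_mono) (use neg_int abs_int in auto)
  moreover have "AE x in M. real_cond_exp M F (\<lambda>x. - f x) x = - real_cond_exp M F f x"
    using real_cond_exp_cmult[OF assms, of "-1"] by simp
  ultimately have "AE x in M. \<bar>real_cond_exp M F f x\<bar> \<le> real_cond_exp M F (\<lambda>x. \<bar>f x\<bar>) x"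
    by eventually_elim auto
  then have "(\<integral>x. \<bar>real_cond_exp M F f x\<bar> \<partial>M) \<le> (\<integral>x. real_cond_exp M F (\<lambda>x. \<bar>f x\<bar>) x \<partial>M)"
    using real_cond_exp_int(1)[OF assms] real_cond_exp_int(1)[OF abs_int]
    by (intro integral_mono_AE) auto
  also have "\<dots> = (\<integral>x. \<bar>f x\<bar> \<partial>M)" by (rule real_cond_exp_int(2)[OF abs_int])
  finally show ?thesis .
qed

context prob_space
begin

lemma sigma_finite_subalgebraI:
  assumes "subalgebra M F"
  shows "sigma_finite_subalgebra M F"
  by (intro finite_measure_subalgebra_is_sigma_finite finite_measure_subalgebra.intro
      finite_measure_subalgebra_axioms.intro finite_measure_axioms assms)

lemma integrable_bounded:
  fixes f :: "'a \<Rightarrow> real"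
  assumes "f \<in> borel_measurable M" and "AE x in M. \<bar>f x\<bar> \<le> c"
  shows "integrable M f"
  by (rule integrable_const_bound[where B = c]) (use assms in auto)

lemma cond_exp_bounded:
  fixes f :: "'a \<Rightarrow> real"
  assumes F: "subalgebra M F" and f: "f \<in> borel_measurable M" "\<And>x. \<bar>f x\<bar> \<le> c"
  shows "AE x in M. \<bar>real_cond_exp M F f x\<bar> \<le> c"
proof -
  interpret F: sigma_finite_subalgebra M F using F by (rule sigma_finite_subalgebraI)
  have int: "integrable M f" by (rule integrable_bounded) (use f in auto)
  have "- c \<le> f x" "f x \<le> c" for x using f(2)[of x] by auto
  then have "AE x in M. - c \<le> real_cond_exp M F f x" "AE x in M. real_cond_exp M F f x \<le> c"
    by (auto intro!: F.real_cond_exp_ge_c[OF int] F.real_cond_exp_le_c[OF int])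
  then show ?thesis by eventually_elim auto
qed

text \<open>
  The full sigma-algebra \<open>M\<close> counts as a subalgebra of itself. This is what lets the variable
  \<open>f\<close> be treated as a conditional expectation of \<open>f\<close>, so that the numerator and the
  denominator of the statistic are two instances of one construction.
\<close>

lemma cond_exp_M_eq:
  assumes "integrable M f"
  shows "AE x in M. real_cond_exp M M f x = f x"
proof -
  interpret F: sigma_finite_subalgebra M M
    by (rule sigma_finite_subalgebraI) (simp add: subalgebra_def)
  show ?thesis by (rule F.real_cond_exp_F_meas) (use assms in auto)
qed

text \<open>
  Dominated convergence gives convergence in L1 of the functions, and the contraction
  property passes it on to their conditional expectations.
\<close>

lemma cond_exp_continuous_L1:
  fixes f :: "'a \<Rightarrow> real"
  assumes F: "subalgebra M F"
    and f: "\<And>n. s n \<in> borel_measurable M" "f \<in> borel_measurable M"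
    and bnd: "\<And>n x. \<bar>s n x\<bar> \<le> c" "\<And>x. \<bar>f x\<bar> \<le> c"
    and lim: "AE x in M. (\<lambda>n. s n x) \<longlonglongrightarrow> f x"
  shows "(\<lambda>n. \<integral>x. \<bar>real_cond_exp M F (s n) x - real_cond_exp M F f x\<bar> \<partial>M) \<longlonglongrightarrow> 0"
proof -
  interpret F: sigma_finite_subalgebra M F using F by (rule sigma_finite_subalgebraI)
  have ints: "integrable M (s n)" and intf: "integrable M f" for n
    by (auto intro!: integrable_bounded[where c = c] simp: f bnd)
  have lim_s: "(\<lambda>n. \<integral>x. \<bar>s n x - f x\<bar> \<partial>M) \<longlonglongrightarrow> 0"
  proof (rule integral_dominated_convergence[where w = "\<lambda>_. 2 * c" and f = "\<lambda>_. 0", simplified])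
    show "AE x in M. (\<lambda>n. \<bar>s n x - f x\<bar>) \<longlonglongrightarrow> 0"
      using lim by eventually_elim (simp add: LIM_zero tendsto_rabs_zero)
    have "\<bar>s n x - f x\<bar> \<le> 2 * c" for n x
      using bnd(1)[of n x] bnd(2)[of x] by linarith
    then show "AE x in M. norm \<bar>s n x - f x\<bar> \<le> 2 * c" for n
      by simp
  qed (use f in auto)
  have "(\<integral>x. \<bar>real_cond_exp M F (s n) x - real_cond_exp M F f x\<bar> \<partial>M)
      \<le> (\<integral>x. \<bar>s n x - f x\<bar> \<partial>M)" for n
  proof -
    have "(\<integral>x. \<bar>real_cond_exp M F (s n) x - real_cond_exp M F f x\<bar> \<partial>M)
        = (\<integral>x. \<bar>real_cond_exp M F (\<lambda>x. s n x - f x) x\<bar> \<partial>M)"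
      using F.real_cond_exp_diff[OF ints[of n] intf]
      by (intro integral_cong_AE) auto
    also have "\<dots> \<le> (\<integral>x. \<bar>s n x - f x\<bar> \<partial>M)"
      by (rule F.real_cond_exp_L1_contraction) (use ints intf in auto)
    finally show ?thesis .
  qed
  then show ?thesis
  proof (intro tendsto_sandwich[OF always_eventually always_eventually tendsto_const lim_s] allI)
    show "0 \<le> (\<integral>x. \<bar>real_cond_exp M F (s n) x - real_cond_exp M F f x\<bar> \<partial>M)" for n
      by simp
  qed
qed

text \<open>
  The tool with which the equality of two conditional expectations is extended from a few
  events to all others: once for approximating orthants by orthants, once for
  countable disjoint unions in a Dynkin argument.
\<close>

lemma cond_exp_agree_limit:
  fixes f :: "'a \<Rightarrow> real"
  assumes F: "subalgebra M F" and G: "subalgebra M G"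
    and f: "\<And>n. s n \<in> borel_measurable M" "f \<in> borel_measurable M"
    and bnd: "\<And>n x. \<bar>s n x\<bar> \<le> c" "\<And>x. \<bar>f x\<bar> \<le> c"
    and lim: "AE x in M. (\<lambda>n. s n x) \<longlonglongrightarrow> f x"
    and agree: "\<And>n. AE x in M. real_cond_exp M F (s n) x = real_cond_exp M G (s n) x"
  shows "AE x in M. real_cond_exp M F f x = real_cond_exp M G f x"
proof -
  interpret F: sigma_finite_subalgebra M F using F by (rule sigma_finite_subalgebraI)
  interpret G: sigma_finite_subalgebra M G using G by (rule sigma_finite_subalgebraI)
  let ?F = "\<lambda>f. real_cond_exp M F f" and ?G = "\<lambda>f. real_cond_exp M G f"
  have ints: "integrable M (s n)" and intf: "integrable M f" for n
    by (auto intro!: integrable_bounded[where c = c] simp: f bnd)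
  note [simp] = F.real_cond_exp_int(1)[OF ints] F.real_cond_exp_int(1)[OF intf]
    G.real_cond_exp_int(1)[OF ints] G.real_cond_exp_int(1)[OF intf]
  have "(\<integral>x. \<bar>?F f x - ?G f x\<bar> \<partial>M)
      \<le> (\<integral>x. \<bar>?F (s n) x - ?F f x\<bar> \<partial>M) + (\<integral>x. \<bar>?G (s n) x - ?G f x\<bar> \<partial>M)" for n
  proof -
    have "(\<integral>x. \<bar>?F f x - ?G f x\<bar> \<partial>M)
        \<le> (\<integral>x. \<bar>?F (s n) x - ?F f x\<bar> + \<bar>?G (s n) x - ?G f x\<bar> \<partial>M)"
    proof (rule integral_mono_AE)
      show "AE x in M. \<bar>?F f x - ?G f x\<bar> \<le> \<bar>?F (s n) x - ?F f x\<bar> + \<bar>?G (s n) x - ?G f x\<bar>"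
        using agree[of n] by eventually_elim linarith
    qed auto
    then show ?thesis by simp
  qed
  moreover have "(\<lambda>n. (\<integral>x. \<bar>?F (s n) x - ?F f x\<bar> \<partial>M) + (\<integral>x. \<bar>?G (s n) x - ?G f x\<bar> \<partial>M)) \<longlonglongrightarrow> 0 + 0"
    by (intro tendsto_add cond_exp_continuous_L1[where c = c] assms)
  ultimately have "(\<integral>x. \<bar>?F f x - ?G f x\<bar> \<partial>M) \<le> 0"
    using LIMSEQ_le_const by fastforce
  then have "(\<integral>x. \<bar>?F f x - ?G f x\<bar> \<partial>M) = 0"
    by (intro antisym) auto
  then have "AE x in M. \<bar>?F f x - ?G f x\<bar> = 0"
    by (subst (asm) integral_nonneg_eq_0_iff_AE) auto
  then show ?thesis by eventually_elim auto
qed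

text \<open>
  The conditional expectation given the smaller sigma-algebra \<open>F\<close> is an orthogonal projection,
  also of the conditional expectation given \<open>G\<close>: as \<open>real_cond_exp M F f\<close> is measurable for
  \<open>F\<close> as well as for \<open>G\<close>, its products with \<open>f\<close>, with \<open>real_cond_exp M G f\<close> and with itself
  have the same integral.
\<close>

lemma cond_exp_pythagoras:
  fixes f :: "'a \<Rightarrow> real"
  assumes FG: "subalgebra G F" and G: "subalgebra M G"
    and f: "f \<in> borel_measurable M" "\<And>x. \<bar>f x\<bar> \<le> c"
  shows "(\<integral>x. (real_cond_exp M G f x - real_cond_exp M F f x)\<^sup>2 \<partial>M)
       = (\<integral>x. (real_cond_exp M G f x)\<^sup>2 \<partial>M) - (\<integral>x. (real_cond_exp M F f x)\<^sup>2 \<partial>M)"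
proof -
  have F: "subalgebra M F" using FG G by (auto simp: subalgebra_def)
  interpret F: sigma_finite_subalgebra M F using F by (rule sigma_finite_subalgebraI)
  interpret G: sigma_finite_subalgebra M G using G by (rule sigma_finite_subalgebraI)
  define a where "a = real_cond_exp M G f"
  define b where "b = real_cond_exp M F f"
  have [measurable]: "a \<in> borel_measurable M" "b \<in> borel_measurable M" "b \<in> borel_measurable F"
    "f \<in> borel_measurable M"
    by (auto simp: a_def b_def f)
  have [measurable]: "b \<in> borel_measurable G"
    by (rule measurable_from_subalg[OF FG]) measurable
  have a: "AE x in M. \<bar>a x\<bar> \<le> c" and b: "AE x in M. \<bar>b x\<bar> \<le> c"
    unfolding a_def b_def using cond_exp_bounded[OF G f] cond_exp_bounded[OF F f] by auto
  have prod: "integrable M (\<lambda>x. u x * v x)"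
    if [measurable]: "u \<in> borel_measurable M" "v \<in> borel_measurable M"
      and "AE x in M. \<bar>u x\<bar> \<le> c" "AE x in M. \<bar>v x\<bar> \<le> c" for u v :: "'a \<Rightarrow> real"
  proof (rule integrable_bounded[where c = "c * c"])
    show "AE x in M. \<bar>u x * v x\<bar> \<le> c * c"
      using that(3,4) by eventually_elim (auto simp: abs_mult intro!: mult_mono)
  qed measurable
  have fb: "AE x in M. \<bar>f x\<bar> \<le> c" using f by simp
  have "(\<integral>x. b x * a x \<partial>M) = (\<integral>x. b x * f x \<partial>M)"
    unfolding a_def by (rule G.real_cond_exp_intg(2)) (auto intro: prod b fb)
  also have "\<dots> = (\<integral>x. b x * b x \<partial>M)"
    unfolding b_def by (rule F.real_cond_exp_intg(2)[symmetric]) (auto intro: prod b[unfolded b_def] fb)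
  finally have ba: "(\<integral>x. b x * a x \<partial>M) = (\<integral>x. b x * b x \<partial>M)" .
  have "(\<integral>x. (a x - b x)\<^sup>2 \<partial>M) = (\<integral>x. a x * a x - 2 * (b x * a x) + b x * b x \<partial>M)"
    by (simp add: power2_eq_square algebra_simps)
  also have "\<dots> = (\<integral>x. a x * a x \<partial>M) - 2 * (\<integral>x. b x * a x \<partial>M) + (\<integral>x. b x * b x \<partial>M)"
    using prod[OF _ _ a a] prod[OF _ _ b a] prod[OF _ _ b b] by simp
  finally show ?thesis
    unfolding ba by (simp add: a_def b_def power2_eq_square)
qed

text \<open>
  From \<open>a\<^sup>2 - b\<^sup>2 = (a + b) (a - b)\<close> and boundedness, the difference of the integrals is at most
  \<open>2 c\<close> times the L1 distance of the conditional expectations.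
\<close>

lemma cond_exp_square_continuous:
  fixes f :: "'a \<Rightarrow> real"
  assumes F: "subalgebra M F"
    and f: "\<And>n. s n \<in> borel_measurable M" "f \<in> borel_measurable M"
    and bnd: "\<And>n x. \<bar>s n x\<bar> \<le> c" "\<And>x. \<bar>f x\<bar> \<le> c"
    and lim: "AE x in M. (\<lambda>n. s n x) \<longlonglongrightarrow> f x"
  shows "(\<lambda>n. \<integral>x. (real_cond_exp M F (s n) x)\<^sup>2 \<partial>M) \<longlonglongrightarrow> (\<integral>x. (real_cond_exp M F f x)\<^sup>2 \<partial>M)"
proof -
  interpret F: sigma_finite_subalgebra M F using F by (rule sigma_finite_subalgebraI)
  let ?E = "\<lambda>f. real_cond_exp M F f"
  have sq: "integrable M (\<lambda>x. (?E g x)\<^sup>2)" and E: "integrable M (?E g)"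
    if "g \<in> borel_measurable M" "\<And>x. \<bar>g x\<bar> \<le> c" for g
  proof -
    have *: "AE x in M. \<bar>?E g x\<bar> \<le> c" by (rule cond_exp_bounded[OF F that])
    then have "AE x in M. \<bar>(?E g x)\<^sup>2\<bar> \<le> c\<^sup>2"
      by eventually_elim (metis abs_ge_zero power2_abs power_abs power_mono)
    then show "integrable M (\<lambda>x. (?E g x)\<^sup>2)"
      by (intro integrable_bounded) auto
    show "integrable M (?E g)" using * by (intro integrable_bounded) auto
  qed
  note [simp] = sq[OF f(1) bnd(1)] sq[OF f(2) bnd(2)] E[OF f(1) bnd(1)] E[OF f(2) bnd(2)]
  have bound: "\<bar>(\<integral>x. (?E (s n) x)\<^sup>2 \<partial>M) - (\<integral>x. (?E f x)\<^sup>2 \<partial>M)\<bar> \<le> 2 * c * (\<integral>x. \<bar>?E (s n) x - ?E f x\<bar> \<partial>M)" for n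
  proof -
    have "\<bar>(\<integral>x. (?E (s n) x)\<^sup>2 \<partial>M) - (\<integral>x. (?E f x)\<^sup>2 \<partial>M)\<bar> = \<bar>\<integral>x. (?E (s n) x)\<^sup>2 - (?E f x)\<^sup>2 \<partial>M\<bar>"
      by simp
    also have "\<dots> \<le> (\<integral>x. \<bar>(?E (s n) x)\<^sup>2 - (?E f x)\<^sup>2\<bar> \<partial>M)" by (rule integral_abs_bound)
    also have "\<dots> \<le> (\<integral>x. 2 * c * \<bar>?E (s n) x - ?E f x\<bar> \<partial>M)"
    proof (rule integral_mono_AE)
      show "AE x in M. \<bar>(?E (s n) x)\<^sup>2 - (?E f x)\<^sup>2\<bar> \<le> 2 * c * \<bar>?E (s n) x - ?E f x\<bar>"
        using cond_exp_bounded[OF F f(1) bnd(1), of n] cond_exp_bounded[OF F f(2) bnd(2)]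
      proof eventually_elim
        case (elim x)
        then have "\<bar>?E (s n) x + ?E f x\<bar> \<le> 2 * c" by linarith
        then show ?case
          by (simp add: power2_eq_square square_diff_square_factored abs_mult mult_right_mono)
      qed
    qed auto
    finally show ?thesis by simp
  qed
  have "(\<lambda>n. 2 * c * (\<integral>x. \<bar>?E (s n) x - ?E f x\<bar> \<partial>M)) \<longlonglongrightarrow> 2 * c * 0"
    by (intro tendsto_mult tendsto_const cond_exp_continuous_L1[where c = c] assms)
  then have "(\<lambda>n. 2 * c * (\<integral>x. \<bar>?E (s n) x - ?E f x\<bar> \<partial>M)) \<longlonglongrightarrow> 0" by simp
  then have "(\<lambda>n. (\<integral>x. (?E (s n) x)\<^sup>2 \<partial>M) - (\<integral>x. (?E f x)\<^sup>2 \<partial>M)) \<longlonglongrightarrow> 0"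
    by (rule Lim_null_comparison[rotated]) (rule always_eventually, simp only: real_norm_def bound, simp)
  then show ?thesis by (simp add: LIM_zero_iff)
qed

end

section \<open>Orthants and the Borel sets\<close>

text \<open>
  Rounding each coordinate of \<open>y\<close> down to a multiple of \<open>1 / (n + 1)\<close> gives a Borel map with
  countable range, so its composition with any \<open>g\<close> is measurable, and these compositions converge to
  \<open>g\<close> because the rounded points approach \<open>y\<close> from below.
\<close>

lemma borel_measurable_if_left_continuous:
  fixes g :: "real^'d \<Rightarrow> real"
  assumes cont: "\<And>y s. (\<And>n. s n \<le> y) \<Longrightarrow> s \<longlonglongrightarrow> y \<Longrightarrow> (\<lambda>n. g (s n)) \<longlonglongrightarrow> g y"
  shows "g \<in> borel_measurable borel"
proof -
  define r :: "nat \<Rightarrow> real^'d \<Rightarrow> real^'d"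
    where "r n y = (\<chi> i. of_int \<lfloor>real (Suc n) * y $ i\<rfloor> / real (Suc n))" for n y
  have r_meas[measurable]: "r n \<in> borel_measurable borel" for n
  proof (subst borel_measurable_euclidean_space, intro ballI)
    fix b :: "real^'d" assume "b \<in> Basis"
    then obtain i where "b = axis i 1" by (auto simp: Basis_vec_def)
    then have "(\<lambda>y. r n y \<bullet> b) = (\<lambda>y. of_int \<lfloor>real (Suc n) * y $ i\<rfloor> / real (Suc n))"
      by (auto simp: r_def inner_axis)
    then show "(\<lambda>y. r n y \<bullet> b) \<in> borel_measurable borel" by simp
  qed
  have r_range: "countable (range (r n))" for n
  proof -
    let ?G = "(\<lambda>x. x / real (Suc n)) ` \<int>"
    have "range (r n) \<subseteq> vec_lambda ` (PiE UNIV (\<lambda>_. ?G))"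
      by (auto simp: r_def intro!: imageI)
    moreover have "countable (PiE (UNIV :: 'd set) (\<lambda>_. ?G))"
      by (intro countable_PiE) (auto simp: Ints_def)
    ultimately show ?thesis by (meson countable_image countable_subset)
  qed
  have "(\<lambda>y. g (r n y)) \<in> borel_measurable borel" for n
  proof (rule measurable_compose_countable'[where f = "\<lambda>z _. g z" and I = "range (r n)"])
    show "r n \<in> borel \<rightarrow>\<^sub>M count_space (range (r n))"
      unfolding measurable_count_space_eq_countable[OF r_range]
      using measurable_sets_borel[OF r_meas, of "{z}" for z] by auto
  qed (auto simp: r_range)
  moreover have "(\<lambda>n. g (r n y)) \<longlonglongrightarrow> g y" for y
  proof (rule cont)
    show "r n y \<le> y" for n
      by (auto simp: r_def less_eq_vec_def divide_le_eq mult.commute)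
    show "(\<lambda>n. r n y) \<longlonglongrightarrow> y"
    proof (rule vec_tendstoI)
      fix i
      have lo: "y $ i - 1 / real (Suc n) \<le> r n y $ i" for n
      proof -
        have "y $ i - 1 / c \<le> of_int \<lfloor>c * y $ i\<rfloor> / c" if "c > 0" for c :: real
        proof -
          have "c * y $ i - 1 \<le> of_int \<lfloor>c * y $ i\<rfloor>" by linarith
          then have "(c * y $ i - 1) / c \<le> of_int \<lfloor>c * y $ i\<rfloor> / c"
            using that by (intro divide_right_mono) auto
          then show ?thesis using that by (simp add: diff_divide_distrib)
        qed
        from this[of "real (Suc n)"] show ?thesis by (simp add: r_def)
      qed
      have up: "r n y $ i \<le> y $ i" for n
        by (auto simp: r_def divide_le_eq mult.commute)
      have lim: "(\<lambda>n. y $ i - 1 / real (Suc n)) \<longlonglongrightarrow> y $ i"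
        using tendsto_diff[OF tendsto_const LIMSEQ_Suc[OF lim_1_over_n[where 'a = real]], of "y $ i"]
        by simp
      show "(\<lambda>n. r n y $ i) \<longlonglongrightarrow> y $ i"
        by (rule tendsto_sandwich[OF always_eventually always_eventually lim tendsto_const])
          (use lo up in auto)
    qed
  qed
  ultimately show ?thesis
    by (rule borel_measurable_LIMSEQ_real[rotated])
qed

lemma orthant_indicator_left_continuous:
  fixes s :: "nat \<Rightarrow> real^'d"
  assumes le: "\<And>n. s n \<le> y" and lim: "s \<longlonglongrightarrow> y"
  shows "eventually (\<lambda>n. s n \<le> v \<longleftrightarrow> y \<le> v) sequentially"
proof (cases "y \<le> v")
  case True
  then have "s n \<le> v" for n by (rule order_trans[OF le])
  then show ?thesis using True by simp
next
  case False
  then obtain i where i: "v $ i < y $ i" by (auto simp: less_eq_vec_def not_le)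
  have "(\<lambda>n. s n $ i) \<longlonglongrightarrow> y $ i" using lim by (rule tendsto_vec_nth)
  then have "eventually (\<lambda>n. v $ i < s n $ i) sequentially" using i by (rule order_tendstoD)
  then show ?thesis
    by eventually_elim (use False in \<open>auto simp: less_eq_vec_def dest: leD\<close>)
qed

text \<open>
  A half space \<open>{x. a \<le> x $ i}\<close> is the union of the orthants whose corner has \<open>i\<close>-th coordinate
  \<open>a\<close> and all other coordinates \<open>- k\<close>.
\<close>

lemma sets_borel_eq_sigma_sets_orthants:
  "sets (borel :: (real^'d) measure) = sigma_sets UNIV (range atLeast)"
proof -
  have "borel = sigma UNIV (range (atLeast :: real^'d \<Rightarrow> _))"
  proof (rule borel_eq_sigmaI4[OF borel_eq_halfspace_ge])
    fix a :: real and b :: "real^'d" assume "(a, b) \<in> UNIV \<times> Basis"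
    then obtain i where b: "b = axis i 1" by (auto simp: Basis_vec_def)
    have *: "{x :: real^'d. a \<le> x \<bullet> b} = (\<Union>k::nat. {(\<chi> j. if j = i then a else - real k)..})"
    proof (intro set_eqI iffI)
      fix x :: "real^'d" assume "x \<in> {x. a \<le> x \<bullet> b}"
      then have x: "a \<le> x $ i" by (simp add: b inner_axis)
      obtain k where k: "Max (range (\<lambda>j. - x $ j)) \<le> real k" using real_arch_simple by blast
      have "- x $ j \<le> real k" for j
        by (rule order_trans[OF Max_ge k]) auto
      then have "- real k \<le> x $ j" for j
        using minus_le_iff by blast
      then show "x \<in> (\<Union>k::nat. {(\<chi> j. if j = i then a else - real k)..})"
        using x by (auto simp: less_eq_vec_def)
    next
      fix x :: "real^'d" assume "x \<in> (\<Union>k::nat. {(\<chi> j. if j = i then a else - real k)..})"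
      then show "x \<in> {x. a \<le> x \<bullet> b}"
        by (auto simp: less_eq_vec_def b inner_axis dest!: spec[of _ i])
    qed
    show "{x :: real^'d. a \<le> x \<bullet> b} \<in> sets (sigma UNIV (range atLeast))"
      unfolding * by (rule sets.countable_UN) auto
  qed auto
  then have "sets (borel :: (real^'d) measure) = sets (sigma UNIV (range atLeast))" by simp
  then show ?thesis by (simp only: sets_measure_of subset_UNIV Pow_UNIV)
qed

section \<open>Approximating orthants by almost all orthants\<close>

text \<open>
  This is the one-dimensional core of the claim that almost every threshold is enough. A single
  threshold \<open>t\<close> may be invisible to the measure \<open>M\<close>, so \<open>t\<close> is first pushed to the right, to
  the end point \<open>s\<close> of the maximal null interval starting at \<open>t\<close>; this does not change the half
  line up to null sets. If \<open>s\<close> is an atom, it can itself be used as threshold. Otherwise every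
  interval to the right of \<open>s\<close> has positive measure, and thresholds from these intervals approximate
  the half line. If \<open>{t..}\<close> is null there is no such \<open>s\<close>, which is why that case is excluded.
\<close>

lemma shrinking_sets_half_line:
  fixes M :: "real measure" and t :: real
  assumes M_borel: "sets M = sets borel" and pos: "emeasure M {t..} \<noteq> 0"
  obtains A :: "nat \<Rightarrow> real set"
  where "\<And>n. A n \<in> sets borel" and "\<And>n. emeasure M (A n) \<noteq> 0"
    and "AE x in M. eventually (\<lambda>n. \<forall>a\<in>A n. a \<le> x \<longleftrightarrow> t \<le> x) sequentially"
proof -
  have [simp]: "space M = UNIV" using sets_eq_imp_space_eq[OF M_borel] by simp
  note [simp] = M_borel
  define S where "S = {s. t \<le> s \<and> emeasure M {t..<s} = 0}"
  have "t \<in> S" by (simp add: S_def)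
  \<comment> \<open>Otherwise \<open>{t..}\<close> would be a countable union of null sets.\<close>
  have "bdd_above S"
  proof (rule ccontr)
    assume "\<not> bdd_above S"
    have "emeasure M {t..<t + real n} = 0" for n
    proof -
      obtain s where "s \<in> S" "t + real n < s"
        using \<open>\<not> bdd_above S\<close> by (auto simp: bdd_above_def not_le)
      then show ?thesis
        using emeasure_mono[of "{t..<t + real n}" "{t..<s}" M] by (auto simp: S_def)
    qed
    then have "emeasure M (\<Union>n. {t..<t + real n}) = 0"
      by (intro emeasure_UN_eq_0) auto
    moreover have "(\<Union>n. {t..<t + real n}) = {t..}"
    proof (intro set_eqI iffI)
      fix x assume "x \<in> {t..}"
      moreover obtain n where "x - t < real n" using reals_Archimedean2 by blast
      ultimately show "x \<in> (\<Union>n. {t..<t + real n})" by (auto intro!: exI[of _ n])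
    qed auto
    ultimately show False using pos by simp
  qed
  define s where "s = Sup S"
  have "t \<le> s" using \<open>t \<in> S\<close> \<open>bdd_above S\<close> by (auto simp: s_def intro: cSup_upper)
  have null: "emeasure M {t..<s} = 0"
  proof -
    have "emeasure M {t..<s - 1 / real (Suc n)} = 0" for n
    proof -
      have "s - 1 / real (Suc n) < Sup S" by (simp add: s_def)
      then obtain r where "r \<in> S" "s - 1 / real (Suc n) < r"
        using less_cSup_iff[of S] \<open>t \<in> S\<close> \<open>bdd_above S\<close> by auto
      then show ?thesis
        using emeasure_mono[of "{t..<s - 1 / real (Suc n)}" "{t..<r}" M] by (auto simp: S_def)
    qed
    then have "emeasure M (\<Union>n. {t..<s - 1 / real (Suc n)}) = 0"
      by (intro emeasure_UN_eq_0) auto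
    moreover have "{t..<s} \<subseteq> (\<Union>n. {t..<s - 1 / real (Suc n)})"
    proof
      fix x assume x: "x \<in> {t..<s}"
      then obtain n where "1 / real (Suc n) < s - x"
        using reals_Archimedean[of "s - x"] by (auto simp: inverse_eq_divide)
      then show "x \<in> (\<Union>n. {t..<s - 1 / real (Suc n)})"
        using x by (auto intro!: exI[of _ n])
    qed
    ultimately show ?thesis
      using emeasure_mono[of "{t..<s}" "\<Union>n. {t..<s - 1 / real (Suc n)}" M] by simp
  qed
  \<comment> \<open>A null interval starting at \<open>s\<close> could be appended, against the maximality of \<open>s\<close>.\<close>
  have pos_right: "emeasure M {s..<s + e} \<noteq> 0" if "e > 0" for e
  proof
    assume "emeasure M {s..<s + e} = 0"
    then have "emeasure M ({t..<s} \<union> {s..<s + e}) = 0"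
      using null by (intro emeasure_Un_null_set[THEN trans]) auto
    moreover have "{t..<s} \<union> {s..<s + e} = {t..<s + e}"
      using \<open>t \<le> s\<close> \<open>e > 0\<close> by auto
    ultimately have "s + e \<in> S" using \<open>t \<le> s\<close> \<open>e > 0\<close> by (auto simp: S_def)
    then have "s + e \<le> s" unfolding s_def using \<open>bdd_above S\<close> by (rule cSup_upper)
    with \<open>e > 0\<close> show False by simp
  qed
  have not_null: "AE x in M. x \<notin> {t..<s}"
    using null by (intro AE_not_in) auto
  show thesis
  proof (cases "emeasure M {s} = 0")
    case False
    show thesis
    proof (rule that[of "\<lambda>_. {s}"])
      show "AE x in M. eventually (\<lambda>n::nat. \<forall>a\<in>{s}. a \<le> x \<longleftrightarrow> t \<le> x) sequentially"
        using not_null by eventually_elim (use \<open>t \<le> s\<close> in auto)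
    qed (use False in auto)
  next
    case True
    then have "AE x in M. x \<notin> {s}" by (intro AE_not_in) auto
    then have *: "AE x in M. x < t \<or> s < x"
      using not_null by eventually_elim auto
    show thesis
    proof (rule that[of "\<lambda>n. {s..<s + 1 / real (Suc n)}"])
      show "AE x in M. eventually (\<lambda>n. \<forall>a\<in>{s..<s + 1 / real (Suc n)}. a \<le> x \<longleftrightarrow> t \<le> x) sequentially"
        using *
      proof eventually_elim
        case (elim x)
        show ?case
        proof (cases "x < t")
          case True
          then show ?thesis using \<open>t \<le> s\<close> by (intro always_eventually) auto
        next
          case False
          then have "s < x" using elim by simp
          then have "eventually (\<lambda>n. 1 / real (Suc n) < x - s) sequentially"
            using LIMSEQ_Suc[OF lim_1_over_n[where 'a = real]] by (intro order_tendstoD) auto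
          then show ?thesis
            by eventually_elim (use False in auto)
        qed
      qed
    qed (use pos_right in auto)
  qed
qed

context prob_space
begin

context
  fixes Y :: "'a \<Rightarrow> real^'d"
  assumes Y[measurable]: "Y \<in> borel_measurable M"
begin

lemma measurable_component[measurable]: "(\<lambda>\<omega>. Y \<omega> $ i) \<in> borel_measurable M"
  using Y borel_measurable_nth by (rule measurable_compose)

lemma measurable_vec_lambda_PiM:
  "vec_lambda \<in> (\<Pi>\<^sub>M i\<in>UNIV. distr M borel (\<lambda>\<omega>. Y \<omega> $ i)) \<rightarrow>\<^sub>M borel"
proof (subst borel_measurable_euclidean_space, intro ballI)
  fix b :: "real^'d" assume "b \<in> Basis"
  then obtain i where "b = axis i 1" by (auto simp: Basis_vec_def)
  then show "(\<lambda>f. vec_lambda f \<bullet> b) \<in> borel_measurable (\<Pi>\<^sub>M i\<in>UNIV. distr M borel (\<lambda>\<omega>. Y \<omega> $ i))"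
    by (simp add: inner_axis)
qed

lemma prob_space_product_of_marginals: "prob_space (product_of_marginals M Y)"
proof -
  interpret P: product_prob_space "\<lambda>i. distr M borel (\<lambda>\<omega>. Y \<omega> $ i)" UNIV
    by (intro product_prob_spaceI prob_space_distr) measurable
  show ?thesis
    unfolding product_of_marginals_def by (rule P.prob_space_distr[OF measurable_vec_lambda_PiM])
qed

lemma sets_product_of_marginals[measurable_cong]: "sets (product_of_marginals M Y) = sets borel"
  by (simp add: product_of_marginals_def)

lemma space_product_of_marginals[simp]: "space (product_of_marginals M Y) = UNIV"
  by (simp add: product_of_marginals_def)

lemma emeasure_product_of_marginals_box:
  assumes [measurable]: "\<And>i. A i \<in> sets borel"
  shows "emeasure (product_of_marginals M Y) {y. \<forall>i. y $ i \<in> A i}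
       = (\<Prod>i\<in>UNIV. emeasure (distr M borel (\<lambda>\<omega>. Y \<omega> $ i)) (A i))"
proof -
  interpret P: product_prob_space "\<lambda>i. distr M borel (\<lambda>\<omega>. Y \<omega> $ i)" UNIV
    by (intro product_prob_spaceI prob_space_distr) measurable
  have [measurable]: "{y :: real^'d. \<forall>i. y $ i \<in> A i} \<in> sets borel"
    by measurable
  have "emeasure (product_of_marginals M Y) {y. \<forall>i. y $ i \<in> A i}
      = emeasure (\<Pi>\<^sub>M i\<in>UNIV. distr M borel (\<lambda>\<omega>. Y \<omega> $ i))
         (vec_lambda -` {y. \<forall>i. y $ i \<in> A i} \<inter> space (\<Pi>\<^sub>M i\<in>UNIV. distr M borel (\<lambda>\<omega>. Y \<omega> $ i)))"
    unfolding product_of_marginals_def by (rule emeasure_distr[OF measurable_vec_lambda_PiM]) measurable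
  also have "vec_lambda -` {y. \<forall>i. y $ i \<in> A i} \<inter> space (\<Pi>\<^sub>M i\<in>UNIV. distr M borel (\<lambda>\<omega>. Y \<omega> $ i))
      = PiE UNIV A"
    by (auto simp: space_PiM)
  finally show ?thesis
    by (simp add: P.emeasure_PiM)
qed

text \<open>
  The boxes built from the one-dimensional shrinking sets have positive measure under the product
  of the marginals, so each of them meets the set \<open>G\<close> of full measure. It is here that the product
  structure matters: the law of \<open>Y\<close> itself might give measure zero to such a box.
\<close>

lemma orthant_ae_limit:
  assumes G: "AE y in product_of_marginals M Y. y \<in> G"
    and pos: "\<And>i. emeasure (distr M borel (\<lambda>\<omega>. Y \<omega> $ i)) {t $ i..} \<noteq> 0"
  obtains y where "\<And>n. y n \<in> G"
    and "AE \<omega> in M. eventually (\<lambda>n. y n \<le> Y \<omega> \<longleftrightarrow> t \<le> Y \<omega>) sequentially"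
proof -
  let ?\<nu> = "\<lambda>i. distr M borel (\<lambda>\<omega>. Y \<omega> $ i)"
  define shrinks where "shrinks i A \<longleftrightarrow> (\<forall>n. A n \<in> sets borel \<and> emeasure (?\<nu> i) (A n) \<noteq> 0) \<and>
      (AE x in ?\<nu> i. eventually (\<lambda>n. \<forall>a\<in>A n. a \<le> x \<longleftrightarrow> t $ i \<le> x) sequentially)"
    for i and A :: "nat \<Rightarrow> real set"
  have "\<exists>A. shrinks i A" for i
  proof (rule shrinking_sets_half_line[OF sets_distr pos[of i]])
    fix A :: "nat \<Rightarrow> real set"
    assume "\<And>n. A n \<in> sets borel" "\<And>n. emeasure (?\<nu> i) (A n) \<noteq> 0"
      "AE x in ?\<nu> i. eventually (\<lambda>n. \<forall>a\<in>A n. a \<le> x \<longleftrightarrow> t $ i \<le> x) sequentially"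
    then show ?thesis by (intro exI[of _ A]) (simp add: shrinks_def)
  qed
  then obtain A where "\<And>i. shrinks i (A i)" by metis
  then have A: "\<And>i n. A i n \<in> sets borel" "\<And>i n. emeasure (?\<nu> i) (A i n) \<noteq> 0"
    and lim: "\<And>i. AE x in ?\<nu> i. eventually (\<lambda>n. \<forall>a\<in>A i n. a \<le> x \<longleftrightarrow> t $ i \<le> x) sequentially"
    by (simp_all add: shrinks_def)
  have "\<exists>y\<in>G. \<forall>i. y $ i \<in> A i n" for n
  proof (rule ccontr)
    assume "\<not> (\<exists>y\<in>G. \<forall>i. y $ i \<in> A i n)"
    then have "AE y in product_of_marginals M Y. y \<notin> {y. \<forall>i. y $ i \<in> A i n}"
      using G by auto
    moreover have "{y :: real^'d. \<forall>i. y $ i \<in> A i n} \<in> sets borel"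
      using A(1) by measurable
    ultimately have "emeasure (product_of_marginals M Y) {y. \<forall>i. y $ i \<in> A i n} = 0"
      by (subst (asm) AE_iff_measurable[where N = "{y. \<forall>i. y $ i \<in> A i n}"])
        (auto simp: sets_product_of_marginals)
    then show False
      using A by (auto simp: emeasure_product_of_marginals_box)
  qed
  then obtain y where y: "\<And>n. y n \<in> G" "\<And>n i. y n $ i \<in> A i n" by metis
  have "AE \<omega> in M. eventually (\<lambda>n. \<forall>a\<in>A i n. a \<le> Y \<omega> $ i \<longleftrightarrow> t $ i \<le> Y \<omega> $ i) sequentially" for i
    using lim[of i] by (rule AE_distrD[rotated]) measurable
  then have "AE \<omega> in M. \<forall>i. eventually (\<lambda>n. \<forall>a\<in>A i n. a \<le> Y \<omega> $ i \<longleftrightarrow> t $ i \<le> Y \<omega> $ i) sequentially"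
    by (subst AE_all_countable) auto
  then have "AE \<omega> in M. eventually (\<lambda>n. y n \<le> Y \<omega> \<longleftrightarrow> t \<le> Y \<omega>) sequentially"
  proof eventually_elim
    case (elim \<omega>)
    then have "eventually (\<lambda>n. \<forall>i. \<forall>a\<in>A i n. a \<le> Y \<omega> $ i \<longleftrightarrow> t $ i \<le> Y \<omega> $ i) sequentially"
      by (subst eventually_all_finite) auto
    then show ?case
      by eventually_elim (use y(2) in \<open>auto simp: less_eq_vec_def\<close>)
  qed
  then show thesis using that y(1) by blast
qed

end
end

section \<open>Energies of conditional probabilities\<close>

text \<open>
  Since versions are chosen separately for each event, this compares the conditional laws of \<open>Y\<close>
  given \<open>F\<close> and given \<open>G\<close> without requiring regular conditional distributions. The instance
  \<open>G = M\<close> says that every event of \<open>Y\<close> is almost surely an event of \<open>F\<close>.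
\<close>

definition same_cond_law ::
  "'a measure \<Rightarrow> 'a measure \<Rightarrow> 'a measure \<Rightarrow> ('a \<Rightarrow> 'b::topological_space) \<Rightarrow> bool" where
  "same_cond_law M F G Y \<longleftrightarrow> (\<forall>A\<in>sets borel. AE \<omega> in M.
     real_cond_exp M F (indicat_real {\<omega>\<in>space M. Y \<omega> \<in> A}) \<omega> =
     real_cond_exp M G (indicat_real {\<omega>\<in>space M. Y \<omega> \<in> A}) \<omega>)"

text \<open>
  The squared L2 norm of the projection of \<open>f\<close> to the functions measurable for \<open>F\<close>.
\<close>

definition energy :: "'a measure \<Rightarrow> 'a measure \<Rightarrow> ('a \<Rightarrow> real) \<Rightarrow> real" where
  "energy M F f = (\<integral>\<omega>. (real_cond_exp M F f \<omega>)\<^sup>2 \<partial>M)"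

context prob_space
begin

text \<open>
  Orthants are closed under intersection and generate the Borel sets, so this is Dynkin's lemma;
  countable disjoint unions are limits of finite ones.
\<close>

lemma same_cond_law_if_orthants:
  fixes Y :: "'a \<Rightarrow> real^'d"
  assumes F: "subalgebra M F" and G: "subalgebra M G" and Y[measurable]: "Y \<in> borel_measurable M"
    and orthants: "\<And>t. AE \<omega> in M. real_cond_exp M F (indicat_real {\<omega>\<in>space M. t \<le> Y \<omega>}) \<omega> =
      real_cond_exp M G (indicat_real {\<omega>\<in>space M. t \<le> Y \<omega>}) \<omega>"
  shows "same_cond_law M F G Y"
  unfolding same_cond_law_def
proof
  interpret F: sigma_finite_subalgebra M F using F by (rule sigma_finite_subalgebraI)
  interpret G: sigma_finite_subalgebra M G using G by (rule sigma_finite_subalgebraI)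
  let ?U = "\<lambda>A. indicat_real {\<omega>\<in>space M. Y \<omega> \<in> A}"
  have int: "integrable M (?U A)" if "A \<in> sets borel" for A
    using that by (intro integrable_bounded[where c = 1]) (auto simp: indicator_def)
  have stable: "Int_stable (range (atLeast :: real^'d \<Rightarrow> _))"
  proof (rule Int_stableI_image)
    fix a b :: "real^'d"
    have "{a..} \<inter> {b..} = {sup a b..}" by auto
    then show "\<exists>k\<in>UNIV. {a..} \<inter> {b..} = {k..}" by blast
  qed
  fix A :: "(real^'d) set" assume "A \<in> sets borel"
  then have "A \<in> sigma_sets UNIV (range atLeast)"
    by (simp add: sets_borel_eq_sigma_sets_orthants)
  from stable subset_UNIV[of "range atLeast", folded Pow_UNIV] this show "AE \<omega> in M. real_cond_exp M F (?U A) \<omega> = real_cond_exp M G (?U A) \<omega>"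
  proof (induction rule: sigma_sets_induct_disjoint)
    case (basic A)
    then obtain t where "A = {t..}" by auto
    then show ?case using orthants[of t] by simp
  next
    case empty
    have "integrable M (\<lambda>_. 0 :: real)" by simp
    from F.real_cond_exp_F_meas[OF this] G.real_cond_exp_F_meas[OF this]
    have "AE \<omega> in M. real_cond_exp M F (\<lambda>_. 0) \<omega> = real_cond_exp M G (\<lambda>_. 0) \<omega>"
      by fastforce
    then show ?case by (simp add: indicator_def)
  next
    case (compl A)
    have A: "A \<in> sets borel"
      using compl(1) by (simp add: sets_borel_eq_sigma_sets_orthants)
    have one: "integrable M (\<lambda>_. 1 :: real)" by simp
    have eq: "AE \<omega> in M. ?U (UNIV - A) \<omega> = 1 - ?U A \<omega>"
      by (auto simp: indicator_def)
    have [measurable]: "?U A \<in> borel_measurable M" "?U (UNIV - A) \<in> borel_measurable M"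
      using int[OF A] int[of "UNIV - A"] A by auto
    have "AE \<omega> in M. real_cond_exp M H (?U (UNIV - A)) \<omega> = 1 - real_cond_exp M H (?U A) \<omega>"
      if "subalgebra M H" for H
    proof -
      interpret H: sigma_finite_subalgebra M H using that by (rule sigma_finite_subalgebraI)
      have "AE \<omega> in M. real_cond_exp M H (?U (UNIV - A)) \<omega> = real_cond_exp M H (\<lambda>\<omega>. 1 - ?U A \<omega>) \<omega>"
        by (rule H.real_cond_exp_cong[OF eq]) measurable
      then show ?thesis
        using H.real_cond_exp_diff[OF one int[OF A]] H.real_cond_exp_F_meas[OF one borel_measurable_const]
        by eventually_elim simp
    qed
    from this[OF F] this[OF G] compl(2) show ?case by auto
  next
    case (union A)
    have A: "A i \<in> sets borel" for i
      using union(2) by (auto simp: sets_borel_eq_sigma_sets_orthants)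
    have UA: "(\<Union>i<n. A i) \<in> sets borel" for n using A by auto
    show ?case
    proof (rule cond_exp_agree_limit[OF F G, where c = 1 and s = "\<lambda>n. ?U (\<Union>i<n. A i)"])
      show "AE x in M. (\<lambda>n. ?U (\<Union>i<n. A i) x) \<longlonglongrightarrow> ?U (\<Union>i. A i) x"
      proof (rule AE_I2)
        fix x assume "x \<in> space M"
        show "(\<lambda>n. ?U (\<Union>i<n. A i) x) \<longlonglongrightarrow> ?U (\<Union>i. A i) x"
        proof (cases "Y x \<in> (\<Union>i. A i)")
          case True
          then obtain i where i: "Y x \<in> A i" by auto
          have "eventually (\<lambda>n. ?U (\<Union>i<n. A i) x = ?U (\<Union>i. A i) x) sequentially"
            using eventually_gt_at_top[of i]
            by eventually_elim (use i in \<open>auto simp: indicator_def\<close>)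
          then show ?thesis by (rule tendsto_eventually)
        qed (auto simp: indicator_def)
      qed
      show "AE x in M. real_cond_exp M F (?U (\<Union>i<n. A i)) x = real_cond_exp M G (?U (\<Union>i<n. A i)) x" for n
      proof -
        have "?U (\<Union>i<n. A i) = (\<lambda>x. \<Sum>i<n. ?U (A i) x)"
        proof
          fix x
          have "{\<omega> \<in> space M. Y \<omega> \<in> (\<Union>i<n. A i)} = (\<Union>i<n. {\<omega> \<in> space M. Y \<omega> \<in> A i})" by auto
          moreover have "disjoint_family_on (\<lambda>i. {\<omega> \<in> space M. Y \<omega> \<in> A i}) {..<n}"
            using union(1) by (auto simp: disjoint_family_on_def)
          ultimately show "?U (\<Union>i<n. A i) x = (\<Sum>i<n. ?U (A i) x)"
            by (simp add: indicator_UN_disjoint)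
        qed
        moreover have "AE x in M. \<forall>i. real_cond_exp M F (?U (A i)) x = real_cond_exp M G (?U (A i)) x"
          using union(3) by (subst AE_all_countable) auto
        ultimately show ?thesis
          using F.real_cond_exp_sum[of "\<lambda>i. ?U (A i)" "{..<n}", OF int[OF A]]
            G.real_cond_exp_sum[of "\<lambda>i. ?U (A i)" "{..<n}", OF int[OF A]] by auto
      qed
    qed (use int[OF UA] int[of "\<Union>i. A i"] A in \<open>auto simp: indicator_def\<close>)
  qed
qed

lemma energy_mono:
  assumes "subalgebra G F" "subalgebra M G" "f \<in> borel_measurable M" "\<And>x. \<bar>f x\<bar> \<le> c"
  shows "energy M F f \<le> energy M G f"
proof -
  have "0 \<le> (\<integral>x. (real_cond_exp M G f x - real_cond_exp M F f x)\<^sup>2 \<partial>M)" by simp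
  then show ?thesis unfolding cond_exp_pythagoras[OF assms] energy_def by simp
qed

lemma energy_eq_iff:
  assumes "subalgebra G F" "subalgebra M G" "f \<in> borel_measurable M" "\<And>x. \<bar>f x\<bar> \<le> c"
  shows "energy M F f = energy M G f \<longleftrightarrow> (AE x in M. real_cond_exp M F f x = real_cond_exp M G f x)"
proof -
  have F: "subalgebra M F" using assms(1,2) by (auto simp: subalgebra_def)
  have "AE x in M. \<bar>(real_cond_exp M G f x - real_cond_exp M F f x)\<^sup>2\<bar> \<le> (2 * c)\<^sup>2"
    using cond_exp_bounded[OF F assms(3,4)] cond_exp_bounded[OF assms(2,3,4)]
  proof eventually_elim
    case (elim x)
    then have "\<bar>real_cond_exp M G f x - real_cond_exp M F f x\<bar> \<le> 2 * c" by linarith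
    then show ?case
      by (metis abs_ge_zero power2_abs power_abs power_mono)
  qed
  then have "integrable M (\<lambda>x. (real_cond_exp M G f x - real_cond_exp M F f x)\<^sup>2)"
    by (intro integrable_bounded) auto
  then have "(\<integral>x. (real_cond_exp M G f x - real_cond_exp M F f x)\<^sup>2 \<partial>M) = 0 \<longleftrightarrow>
      (AE x in M. (real_cond_exp M G f x - real_cond_exp M F f x)\<^sup>2 = 0)"
    by (intro integral_nonneg_eq_0_iff_AE) auto
  then show ?thesis
    unfolding cond_exp_pythagoras[OF assms] energy_def[symmetric]
    by (simp add: eq_commute[of "energy M F f"] eq_commute[of "real_cond_exp M F f _"])
qed

lemma energy_bounds:
  assumes F: "subalgebra M F" and f: "f \<in> borel_measurable M" "\<And>x. \<bar>f x\<bar> \<le> 1"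
  shows "0 \<le> energy M F f" "energy M F f \<le> 1"
proof -
  show "0 \<le> energy M F f" by (simp add: energy_def)
  have *: "AE x in M. (real_cond_exp M F f x)\<^sup>2 \<le> 1"
    using cond_exp_bounded[OF F f] by eventually_elim (simp add: abs_square_le_1)
  then have "integrable M (\<lambda>x. (real_cond_exp M F f x)\<^sup>2)"
    by (intro integrable_bounded[where c = 1]) auto
  then have "energy M F f \<le> (\<integral>x. 1 \<partial>M)"
    unfolding energy_def using * by (intro integral_mono_AE) auto
  then show "energy M F f \<le> 1" by (simp add: prob_space)
qed

context
  fixes Y :: "'a \<Rightarrow> real^'d"
  assumes Y[measurable]: "Y \<in> borel_measurable M"
begin

lemma orthant_indicator_measurable:
  "indicat_real {\<omega>\<in>space M. t \<le> Y \<omega>} \<in> borel_measurable M"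
proof -
  have "{\<omega>\<in>space M. t \<le> Y \<omega>} = Y -` {t..} \<inter> space M" by auto
  also have "\<dots> \<in> sets M" by (rule measurable_sets[OF Y]) (simp add: borel_closed)
  finally show ?thesis by simp
qed

text \<open>
  This makes the integrals in the numerator and denominator genuine. Monotonicity of
  \<open>y \<mapsto> energy M F 1{y \<le> Y}\<close> would not suffice in dimension two or more; continuity from
  below does.
\<close>

lemma energy_orthant_measurable:
  assumes F: "subalgebra M F"
  shows "(\<lambda>y. energy M F (indicat_real {\<omega>\<in>space M. y \<le> Y \<omega>})) \<in> borel_measurable borel"
proof (rule borel_measurable_if_left_continuous)
  fix y and s :: "nat \<Rightarrow> real^'d"
  assume s: "\<And>n. s n \<le> y" "s \<longlonglongrightarrow> y"
  show "(\<lambda>n. energy M F (indicat_real {\<omega>\<in>space M. s n \<le> Y \<omega>}))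
      \<longlonglongrightarrow> energy M F (indicat_real {\<omega>\<in>space M. y \<le> Y \<omega>})"
    unfolding energy_def
  proof (rule cond_exp_square_continuous[OF F orthant_indicator_measurable orthant_indicator_measurable,
        where c = 1])
    show "AE x in M. (\<lambda>n. indicat_real {\<omega>\<in>space M. s n \<le> Y \<omega>} x)
        \<longlonglongrightarrow> indicat_real {\<omega>\<in>space M. y \<le> Y \<omega>} x"
    proof (rule AE_I2, rule tendsto_eventually)
      fix x
      show "eventually (\<lambda>n. indicat_real {\<omega>\<in>space M. s n \<le> Y \<omega>} x =
          indicat_real {\<omega>\<in>space M. y \<le> Y \<omega>} x) sequentially"
        using orthant_indicator_left_continuous[OF s, of "Y x"]
        by eventually_elim (simp add: indicator_def)
    qed
  qed (auto simp: indicator_def)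
qed

lemma energy_orthant_integrable:
  assumes F: "subalgebra M F"
  shows "integrable (product_of_marginals M Y) (\<lambda>y. energy M F (indicat_real {\<omega>\<in>space M. y \<le> Y \<omega>}))"
proof -
  interpret P: prob_space "product_of_marginals M Y"
    by (rule prob_space_product_of_marginals[OF Y])
  show ?thesis
  proof (rule P.integrable_bounded[where c = 1])
    show "(\<lambda>y. energy M F (indicat_real {\<omega>\<in>space M. y \<le> Y \<omega>}))
        \<in> borel_measurable (product_of_marginals M Y)"
      using energy_orthant_measurable[OF F]
      by (simp cong: measurable_cong_sets add: sets_product_of_marginals[OF Y])
    have "\<bar>energy M F (indicat_real {\<omega>\<in>space M. y \<le> Y \<omega>})\<bar> \<le> 1" for y
      using energy_bounds[OF F orthant_indicator_measurable[of y]] by (simp add: indicator_def)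
    then show "AE y in product_of_marginals M Y.
        \<bar>energy M F (indicat_real {\<omega>\<in>space M. y \<le> Y \<omega>})\<bar> \<le> 1"
      by simp
  qed
qed

text \<open>
  Every orthant \<open>{t..}\<close> either has probability zero, because one of its sides does, or is the almost
  sure limit of orthants from the set of full measure on which agreement is known.
\<close>

lemma same_cond_law_if_ae_orthants:
  assumes F: "subalgebra M F" and G: "subalgebra M G"
    and ae: "AE y in product_of_marginals M Y. AE \<omega> in M.
      real_cond_exp M F (indicat_real {\<omega>\<in>space M. y \<le> Y \<omega>}) \<omega> =
      real_cond_exp M G (indicat_real {\<omega>\<in>space M. y \<le> Y \<omega>}) \<omega>"
  shows "same_cond_law M F G Y"
proof (rule same_cond_law_if_orthants[OF F G Y])
  fix t :: "real^'d"
  let ?U = "\<lambda>y. indicat_real {\<omega>\<in>space M. y \<le> Y \<omega>}"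
  show "AE \<omega> in M. real_cond_exp M F (?U t) \<omega> = real_cond_exp M G (?U t) \<omega>"
  proof (cases "\<exists>i. emeasure (distr M borel (\<lambda>\<omega>. Y \<omega> $ i)) {t $ i..} = 0")
    case True
    then obtain i where "emeasure (distr M borel (\<lambda>\<omega>. Y \<omega> $ i)) {t $ i..} = 0" by auto
    then have "AE x in distr M borel (\<lambda>\<omega>. Y \<omega> $ i). x \<notin> {t $ i..}"
      by (intro AE_not_in) auto
    then have "AE \<omega> in M. Y \<omega> $ i \<notin> {t $ i..}"
      by (rule AE_distrD[rotated]) (rule measurable_component[OF Y])
    then have zero: "AE \<omega> in M. ?U t \<omega> = 0"
      by eventually_elim (auto simp: indicator_def less_eq_vec_def)
    have "AE \<omega> in M. real_cond_exp M H (?U t) \<omega> = 0" if "subalgebra M H" for H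
    proof -
      interpret H: sigma_finite_subalgebra M H using that by (rule sigma_finite_subalgebraI)
      have "AE \<omega> in M. real_cond_exp M H (?U t) \<omega> = real_cond_exp M H (\<lambda>_. 0) \<omega>"
        by (rule H.real_cond_exp_cong[OF zero]) (auto intro: orthant_indicator_measurable)
      moreover have "AE \<omega> in M. real_cond_exp M H (\<lambda>_. 0) \<omega> = 0"
        by (rule H.real_cond_exp_F_meas) auto
      ultimately show ?thesis by eventually_elim simp
    qed
    from this[OF F] this[OF G] show ?thesis by eventually_elim simp
  next
    case False
    then have pos: "\<And>i. emeasure (distr M borel (\<lambda>\<omega>. Y \<omega> $ i)) {t $ i..} \<noteq> 0" by blast
    let ?G = "{y. AE \<omega> in M. real_cond_exp M F (?U y) \<omega> = real_cond_exp M G (?U y) \<omega>}"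
    have "AE y in product_of_marginals M Y. y \<in> ?G" using ae by simp
    then show ?thesis
    proof (rule orthant_ae_limit[OF Y _ pos])
      fix y :: "nat \<Rightarrow> real^'d"
      assume y: "\<And>n. y n \<in> ?G"
        and lim: "AE \<omega> in M. eventually (\<lambda>n. y n \<le> Y \<omega> \<longleftrightarrow> t \<le> Y \<omega>) sequentially"
      show ?thesis
      proof (rule cond_exp_agree_limit[OF F G orthant_indicator_measurable orthant_indicator_measurable,
            where c = 1])
        show "AE \<omega> in M. real_cond_exp M F (?U (y n)) \<omega> = real_cond_exp M G (?U (y n)) \<omega>" for n
          using y[of n] by simp
        show "AE \<omega> in M. (\<lambda>n. ?U (y n) \<omega>) \<longlonglongrightarrow> ?U t \<omega>"
          using lim
        proof eventually_elim
          case (elim \<omega>)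
          then have "eventually (\<lambda>n. ?U (y n) \<omega> = ?U t \<omega>) sequentially"
            by eventually_elim (simp add: indicator_def)
          then show ?case by (rule tendsto_eventually)
        qed
      qed (auto simp: indicator_def)
    qed
  qed
qed

text \<open>
  By the Pythagorean identity the integrand is, for each \<open>y\<close>, the squared L2 distance of the two
  conditional probabilities of the orthant at \<open>y\<close>. All three parts of the final theorem are instances
  of this proposition.
\<close>

proposition integrated_energy_gap:
  assumes FG: "subalgebra G F" and G: "subalgebra M G"
  defines "gap \<equiv> \<integral>y. energy M G (indicat_real {\<omega>\<in>space M. y \<le> Y \<omega>}) -
      energy M F (indicat_real {\<omega>\<in>space M. y \<le> Y \<omega>}) \<partial>product_of_marginals M Y"
  shows "0 \<le> gap" and "gap = 0 \<longleftrightarrow> same_cond_law M F G Y"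
proof -
  let ?U = "\<lambda>y. indicat_real {\<omega>\<in>space M. y \<le> Y \<omega>}"
  have F: "subalgebra M F" using FG G by (auto simp: subalgebra_def)
  have bnd: "\<bar>?U y x\<bar> \<le> 1" for y x by (simp add: indicator_def)
  note mono = energy_mono[OF FG G orthant_indicator_measurable bnd]
  note eq_iff = energy_eq_iff[OF FG G orthant_indicator_measurable bnd]
  show "0 \<le> gap" unfolding gap_def using mono by (intro Bochner_Integration.integral_nonneg) auto
  have "gap = 0 \<longleftrightarrow> (AE y in product_of_marginals M Y. energy M G (?U y) - energy M F (?U y) = 0)"
    unfolding gap_def using mono energy_orthant_integrable[OF F] energy_orthant_integrable[OF G]
    by (intro integral_nonneg_eq_0_iff_AE) auto
  also have "\<dots> \<longleftrightarrow> (AE y in product_of_marginals M Y. AE \<omega> in M.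
      real_cond_exp M F (?U y) \<omega> = real_cond_exp M G (?U y) \<omega>)"
    by (simp add: eq_iff[symmetric] eq_commute[of "energy M F _"])
  also have "\<dots> \<longleftrightarrow> same_cond_law M F G Y"
  proof
    assume law: "same_cond_law M F G Y"
    have "AE \<omega> in M. real_cond_exp M F (?U y) \<omega> = real_cond_exp M G (?U y) \<omega>" for y
      using law[unfolded same_cond_law_def, rule_format, of "{y..}"] by (simp add: borel_closed)
    then show "AE y in product_of_marginals M Y. AE \<omega> in M.
      real_cond_exp M F (?U y) \<omega> = real_cond_exp M G (?U y) \<omega>" by simp
  qed (rule same_cond_law_if_ae_orthants[OF F G])
  finally show "gap = 0 \<longleftrightarrow> same_cond_law M F G Y" .
qed

end
end

section \<open>Expected conditional variances as energy gaps\<close>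

text \<open>
  Stated for a measure \<open>N\<close> other than \<open>M\<close> so that it also yields the inclusion of
  \<open>sigma_gen M X\<close> in the sigma-algebra generated by a pair \<open>(Z, X)\<close>.
\<close>

lemma sigma_gen_subalgebra:
  assumes "X \<in> borel_measurable N" and "space N = space M"
  shows "subalgebra N (sigma_gen M X)"
  using measurable_sets[OF assms(1)] assms(2)
  by (auto simp: subalgebra_def sigma_gen_def sets_vimage_algebra2)

lemma sets_sigma_gen: "sets (sigma_gen M X) = {X -` A \<inter> space M | A. A \<in> sets borel}"
  by (simp add: sigma_gen_def sets_vimage_algebra2)

lemma space_sigma_gen[simp]: "space (sigma_gen M X) = space M"
  by (simp add: sigma_gen_def)

lemma measurable_sigma_gen: "X \<in> borel_measurable (sigma_gen M X)"
  unfolding sigma_gen_def by (rule measurable_vimage_algebra1) auto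

context prob_space
begin

text \<open>
  The outer conditional expectation disappears under the integral.
\<close>

lemma expectation_cond_variance:
  assumes X: "X \<in> borel_measurable M" and f: "f \<in> borel_measurable M" "AE x in M. \<bar>f x\<bar> \<le> c"
  shows "(\<integral>\<omega>. cond_variance M X f \<omega> \<partial>M) = (\<integral>\<omega>. (f \<omega> - real_cond_exp M (sigma_gen M X) f \<omega>)\<^sup>2 \<partial>M)"
proof -
  let ?F = "sigma_gen M X"
  interpret F: sigma_finite_subalgebra M ?F
    using sigma_gen_subalgebra[OF X refl] by (rule sigma_finite_subalgebraI)
  have int: "integrable M f" using f by (rule integrable_bounded)
  have "- c \<le> f x \<and> f x \<le> c" if "\<bar>f x\<bar> \<le> c" for x using that by auto
  then have "AE x in M. - c \<le> real_cond_exp M ?F f x" "AE x in M. real_cond_exp M ?F f x \<le> c"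
    using f(2) by (auto intro!: F.real_cond_exp_ge_c[OF int] F.real_cond_exp_le_c[OF int])
  with f(2) have "AE x in M. \<bar>(f x - real_cond_exp M ?F f x)\<^sup>2\<bar> \<le> (2 * c)\<^sup>2"
  proof eventually_elim
    case (elim x)
    then have "\<bar>f x - real_cond_exp M ?F f x\<bar> \<le> 2 * c" by linarith
    then show ?case by (metis abs_ge_zero power2_abs power_abs power_mono)
  qed
  then have "integrable M (\<lambda>x. (f x - real_cond_exp M ?F f x)\<^sup>2)"
    using f(1) by (intro integrable_bounded) auto
  then show ?thesis
    unfolding cond_variance_def cond_expectation_def by (rule F.real_cond_exp_int(2))
qed

lemma expectation_cond_variance_cond_exp:
  assumes X: "X \<in> borel_measurable M" and XG: "subalgebra G (sigma_gen M X)" and G: "subalgebra M G"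
    and f: "f \<in> borel_measurable M" "\<And>x. \<bar>f x\<bar> \<le> c"
  shows "(\<integral>\<omega>. cond_variance M X (real_cond_exp M G f) \<omega> \<partial>M) = energy M G f - energy M (sigma_gen M X) f"
proof -
  let ?F = "sigma_gen M X"
  interpret F: sigma_finite_subalgebra M ?F
    using sigma_gen_subalgebra[OF X refl] by (rule sigma_finite_subalgebraI)
  have int: "integrable M f" by (rule integrable_bounded) (use f in auto)
  have "(\<integral>\<omega>. cond_variance M X (real_cond_exp M G f) \<omega> \<partial>M)
      = (\<integral>\<omega>. (real_cond_exp M G f \<omega> - real_cond_exp M ?F (real_cond_exp M G f) \<omega>)\<^sup>2 \<partial>M)"
    by (rule expectation_cond_variance[OF X _ cond_exp_bounded[OF G f]]) simp
  also have "\<dots> = (\<integral>\<omega>. (real_cond_exp M G f \<omega> - real_cond_exp M ?F f \<omega>)\<^sup>2 \<partial>M)"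
    using F.real_cond_exp_nested_subalg[OF G XG int] by (intro integral_cong_AE) auto
  also have "\<dots> = energy M G f - energy M ?F f"
    unfolding energy_def by (rule cond_exp_pythagoras[OF XG G f])
  finally show ?thesis .
qed

lemma expectation_cond_variance_energy:
  assumes X: "X \<in> borel_measurable M"
    and f: "f \<in> borel_measurable M" "\<And>x. \<bar>f x\<bar> \<le> c"
  shows "(\<integral>\<omega>. cond_variance M X f \<omega> \<partial>M) = energy M M f - energy M (sigma_gen M X) f"
proof -
  let ?F = "sigma_gen M X"
  have F: "subalgebra M ?F" using X by (rule sigma_gen_subalgebra) simp
  have MM: "subalgebra M M" by (simp add: subalgebra_def)
  have int: "integrable M f" by (rule integrable_bounded) (use f in auto)
  have "(\<integral>\<omega>. cond_variance M X f \<omega> \<partial>M) = (\<integral>\<omega>. (f \<omega> - real_cond_exp M ?F f \<omega>)\<^sup>2 \<partial>M)"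
    by (rule expectation_cond_variance[OF X f(1)]) (use f(2) in auto)
  also have "\<dots> = (\<integral>\<omega>. (real_cond_exp M M f \<omega> - real_cond_exp M ?F f \<omega>)\<^sup>2 \<partial>M)"
    using cond_exp_M_eq[OF int] f(1) by (intro integral_cong_AE) auto
  also have "\<dots> = energy M M f - energy M ?F f"
    unfolding energy_def by (rule cond_exp_pythagoras[OF F MM f])
  finally show ?thesis .
qed

section \<open>Functional dependence and conditional independence\<close>

text \<open>
  If \<open>Y\<close> is a function of \<open>W\<close>, its events are events of \<open>W\<close>. Conversely, each event
  \<open>{q \<le> Y $ i}\<close> with \<open>q\<close> rational coincides almost surely with \<open>{W \<in> B i q}\<close> for a Borel set
  \<open>B i q\<close>. Each coordinate of \<open>Y\<close> is the supremum of the rationals below it, so replacing the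
  events of \<open>Y\<close> by those of \<open>W\<close> in this supremum defines the required function.
\<close>

lemma ae_function_of_iff_same_cond_law:
  fixes Y :: "'a \<Rightarrow> real^'d" and W :: "'a \<Rightarrow> 'c::topological_space"
  assumes Y[measurable]: "Y \<in> borel_measurable M" and W[measurable]: "W \<in> borel_measurable M"
  shows "ae_function_of M Y W \<longleftrightarrow> same_cond_law M (sigma_gen M W) M Y"
proof
  let ?F = "sigma_gen M W" and ?U = "\<lambda>A. indicat_real {\<omega>\<in>space M. Y \<omega> \<in> A}"
  interpret F: sigma_finite_subalgebra M ?F
    using sigma_gen_subalgebra[OF W refl] by (rule sigma_finite_subalgebraI)
  have int: "integrable M (?U A)" if "A \<in> sets borel" for A
    using that by (intro integrable_bounded[where c = 1]) (auto simp: indicator_def)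
  {
    assume "ae_function_of M Y W"
    then obtain f where f[measurable]: "f \<in> borel_measurable borel" and eq: "AE \<omega> in M. Y \<omega> = f (W \<omega>)"
      by (auto simp: ae_function_of_def)
    show "same_cond_law M ?F M Y"
      unfolding same_cond_law_def
    proof
      fix A :: "(real^'d) set" assume A[measurable]: "A \<in> sets borel"
      have fW: "(\<lambda>\<omega>. indicat_real A (f (W \<omega>))) \<in> borel_measurable ?F"
        using measurable_sigma_gen[of W M] by measurable
      have ae: "AE \<omega> in M. ?U A \<omega> = indicat_real A (f (W \<omega>))"
        using eq AE_space by eventually_elim (simp add: indicator_def)
      have "AE \<omega> in M. real_cond_exp M ?F (?U A) \<omega> = real_cond_exp M ?F (\<lambda>\<omega>. indicat_real A (f (W \<omega>))) \<omega>"
        by (rule F.real_cond_exp_cong[OF ae]) measurable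
      moreover have "AE \<omega> in M. real_cond_exp M ?F (\<lambda>\<omega>. indicat_real A (f (W \<omega>))) \<omega> = indicat_real A (f (W \<omega>))"
        by (rule F.real_cond_exp_F_meas[OF _ fW], rule integrable_bounded[where c = 1])
          (auto simp: indicator_def)
      ultimately show "AE \<omega> in M. real_cond_exp M ?F (?U A) \<omega> = real_cond_exp M M (?U A) \<omega>"
        using ae cond_exp_M_eq[OF int[OF A]] by eventually_elim simp
    qed
  }
  {
    assume law: "same_cond_law M ?F M Y"
    define describes where "describes i q B \<longleftrightarrow>
        B \<in> sets borel \<and> (AE \<omega> in M. W \<omega> \<in> B \<longleftrightarrow> real_of_rat q \<le> Y \<omega> $ i)" for i q B
    have "\<exists>B. describes i q B" for i q
    proof -
      let ?A = "{y :: real^'d. real_of_rat q \<le> y $ i}"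
      have A[measurable]: "?A \<in> sets borel" by measurable
      have "{\<omega>\<in>space ?F. real_cond_exp M ?F (?U ?A) \<omega> = 1} \<in> sets ?F" by measurable
      then obtain B where B: "B \<in> sets borel"
        "{\<omega>\<in>space ?F. real_cond_exp M ?F (?U ?A) \<omega> = 1} = W -` B \<inter> space M"
        by (auto simp: sets_sigma_gen)
      have "AE \<omega> in M. real_cond_exp M ?F (?U ?A) \<omega> = real_cond_exp M M (?U ?A) \<omega>"
        using law A unfolding same_cond_law_def by (rule bspec)
      with cond_exp_M_eq[OF int[OF A]] AE_space
      have "AE \<omega> in M. W \<omega> \<in> B \<longleftrightarrow> real_of_rat q \<le> Y \<omega> $ i"
      proof eventually_elim
        case (elim \<omega>)
        have "W \<omega> \<in> B \<longleftrightarrow> \<omega> \<in> W -` B \<inter> space M" using elim by simp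
        also have "\<dots> \<longleftrightarrow> ?U ?A \<omega> = 1" unfolding B(2)[symmetric] using elim by simp
        finally have "W \<omega> \<in> B \<longleftrightarrow> ?U ?A \<omega> = 1" .
        then show ?case using elim by (simp add: indicator_def)
      qed
      with B(1) show ?thesis by (intro exI[of _ B]) (simp add: describes_def)
    qed
    then obtain B where "\<And>i q. describes i q (B i q)" by metis
    then have B[measurable]: "\<And>i q. B i q \<in> sets borel"
      and B_ae: "\<And>i q. AE \<omega> in M. W \<omega> \<in> B i q \<longleftrightarrow> real_of_rat q \<le> Y \<omega> $ i"
      by (simp_all add: describes_def)
    \<comment> \<open>The supremum is taken in the extended reals, as it may be infinite at
    values that \<open>W\<close> takes with probability zero.\<close>
    define g where "g i w = (SUP q. if w \<in> B i q then ereal (real_of_rat q) else - \<infinity>)" for i w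
    have g[measurable]: "g i \<in> borel_measurable borel" for i
      unfolding g_def by measurable
    define f :: "'c \<Rightarrow> real^'d" where "f w = (\<chi> i. real_of_ereal (g i w))" for w
    have "f \<in> borel_measurable borel"
    proof (subst borel_measurable_euclidean_space, intro ballI)
      fix b :: "real^'d" assume "b \<in> Basis"
      then obtain i where "b = axis i 1" by (auto simp: Basis_vec_def)
      then show "(\<lambda>w. f w \<bullet> b) \<in> borel_measurable borel"
        by (simp add: inner_axis f_def)
    qed
    moreover have "AE \<omega> in M. \<forall>i q. W \<omega> \<in> B i q \<longleftrightarrow> real_of_rat q \<le> Y \<omega> $ i"
      using B_ae by (simp add: AE_all_countable)
    then have "AE \<omega> in M. Y \<omega> = f (W \<omega>)"
    proof eventually_elim
      case (elim \<omega>)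
      have "g i (W \<omega>) = ereal (Y \<omega> $ i)" for i
        unfolding g_def
      proof (rule SUP_eqI)
        show "(if W \<omega> \<in> B i q then ereal (real_of_rat q) else - \<infinity>) \<le> ereal (Y \<omega> $ i)" for q
          using elim by auto
        fix u assume u: "\<And>q. q \<in> UNIV \<Longrightarrow> (if W \<omega> \<in> B i q then ereal (real_of_rat q) else - \<infinity>) \<le> u"
        show "ereal (Y \<omega> $ i) \<le> u"
        proof (rule ccontr)
          assume "\<not> ereal (Y \<omega> $ i) \<le> u"
          then have "u < ereal (Y \<omega> $ i)" by simp
          then obtain r where r: "u < ereal r" "ereal r < ereal (Y \<omega> $ i)"
            using ereal_dense2 by blast
          then obtain q where q: "r < real_of_rat q" "real_of_rat q < Y \<omega> $ i"
            using of_rat_dense[of r "Y \<omega> $ i"] by auto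
          then have "ereal (real_of_rat q) \<le> u" using u[of q] elim by simp
          also have "u < ereal r" by fact
          also have "ereal r < ereal (real_of_rat q)" using q(1) by simp
          finally show False .
        qed
      qed
      then show ?case by (simp add: f_def vec_eq_iff)
    qed
    ultimately show "ae_function_of M Y W"
      by (auto simp: ae_function_of_def)
  }
qed

text \<open>
  Two integrable densities are compared on the events of \<open>(Z, X)\<close> through their difference
  \<open>h\<close>; the rectangles generate the product sigma-algebra and are closed under intersection.
\<close>

lemma set_integral_eq_0_if_rectangles:
  fixes h :: "'a \<Rightarrow> real"
    and Z :: "'a \<Rightarrow> 'c::second_countable_topology" and X :: "'a \<Rightarrow> 'd::second_countable_topology"
  assumes h: "integrable M h"
    and [measurable]: "Z \<in> borel_measurable M" "X \<in> borel_measurable M"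
    and rect: "\<And>B C. B \<in> sets borel \<Longrightarrow> C \<in> sets borel \<Longrightarrow>
      (LINT \<omega>:(\<lambda>\<omega>. (Z \<omega>, X \<omega>)) -` (B \<times> C) \<inter> space M|M. h \<omega>) = 0"
    and D: "D \<in> sets borel"
  shows "(LINT \<omega>:(\<lambda>\<omega>. (Z \<omega>, X \<omega>)) -` D \<inter> space M|M. h \<omega>) = 0"
proof -
  let ?V = "\<lambda>D. (\<lambda>\<omega>. (Z \<omega>, X \<omega>)) -` D \<inter> space M"
  have V: "?V D \<in> sets M" if "D \<in> sets (borel \<Otimes>\<^sub>M borel)" for D
    using that by measurable
  have si: "set_integrable M S h" if "S \<in> sets M" for S
    using that h integrable_mult_indicator[of S M h] by (simp add: set_integrable_def)
  have D': "D \<in> sigma_sets (space borel \<times> space borel) {a \<times> b |a b. a \<in> sets (borel :: 'c measure) \<and> b \<in> sets (borel :: 'd measure)}"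
    using D unfolding borel_prod[symmetric] sets_pair_measure .
  have closed: "{a \<times> b |a b. a \<in> sets (borel :: 'c measure) \<and> b \<in> sets (borel :: 'd measure)}
      \<subseteq> Pow (space borel \<times> space borel)"
    by auto
  have whole: "(LINT \<omega>:space M|M. h \<omega>) = 0"
    using rect[of UNIV UNIV] by simp
  show ?thesis
    using Int_stable_pair_measure_generator closed D'
  proof (induction rule: sigma_sets_induct_disjoint)
    case (basic A)
    then show ?case using rect by auto
  next
    case empty
    show ?case by (simp add: set_lebesgue_integral_def)
  next
    case (compl A)
    then have A: "A \<in> sets (borel \<Otimes>\<^sub>M borel)" unfolding sets_pair_measure by simp
    have "space M = ?V (space borel \<times> space borel - A) \<union> ?V A" by auto
    then have "(LINT \<omega>:space M|M. h \<omega>)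
        = (LINT \<omega>:?V (space borel \<times> space borel - A)|M. h \<omega>) + (LINT \<omega>:?V A|M. h \<omega>)"
      using V[OF A] V[of "space borel \<times> space borel - A"] A
      by (subst set_integral_Un[symmetric]) (auto intro!: si simp: space_pair_measure[symmetric])
    then show ?case using whole compl by simp
  next
    case (union A)
    then have A: "A i \<in> sets (borel \<Otimes>\<^sub>M borel)" for i unfolding sets_pair_measure by auto
    have eq: "?V (\<Union>i. A i) = (\<Union>i. ?V (A i))" by auto
    have "(LINT \<omega>:?V (\<Union>i. A i)|M. h \<omega>) = (\<Sum>i. LINT \<omega>:?V (A i)|M. h \<omega>)"
      unfolding eq
    proof (rule lebesgue_integral_countable_add)
      show "?V (A i) \<inter> ?V (A j) = {}" if "i \<noteq> j" for i j
        using union(1) that by (fastforce simp: disjoint_family_on_def)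
    qed (use V A in \<open>auto intro!: si\<close>)
    then show ?case using union by simp
  qed
qed

text \<open>
  Conditional independence means that, once \<open>X\<close> is known, learning \<open>Z\<close> does not change the
  conditional law of \<open>Y\<close>. From equal conditional laws, independence follows by conditioning on
  \<open>(Z, X)\<close> first and pulling out the indicator of the event of \<open>Z\<close>. For the converse, the
  factorization says that \<open>P(Y \<in> A | X)\<close> has the defining integrals of \<open>P(Y \<in> A | Z, X)\<close> over all
  rectangles, hence over all events of \<open>(Z, X)\<close>.
\<close>

lemma cond_indep_iff_same_cond_law:
  fixes Z :: "'a \<Rightarrow> 'c::second_countable_topology" and X :: "'a \<Rightarrow> 'd::second_countable_topology"
    and Y :: "'a \<Rightarrow> 'b::topological_space"
  assumes Y[measurable]: "Y \<in> borel_measurable M"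
    and Z[measurable]: "Z \<in> borel_measurable M" and X[measurable]: "X \<in> borel_measurable M"
  shows "cond_indep M Y Z X \<longleftrightarrow> same_cond_law M (sigma_gen M X) (sigma_gen M (\<lambda>\<omega>. (Z \<omega>, X \<omega>))) Y"
proof -
  let ?F = "sigma_gen M X" and ?G = "sigma_gen M (\<lambda>\<omega>. (Z \<omega>, X \<omega>))"
  let ?U = "\<lambda>A. indicat_real {\<omega>\<in>space M. Y \<omega> \<in> A}" and ?V = "\<lambda>B. indicat_real {\<omega>\<in>space M. Z \<omega> \<in> B}"
  let ?UV = "\<lambda>A B. indicat_real {\<omega>\<in>space M. Y \<omega> \<in> A \<and> Z \<omega> \<in> B}"
  have ZX: "(\<lambda>\<omega>. (Z \<omega>, X \<omega>)) \<in> borel_measurable M" by measurable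
  note F = sigma_gen_subalgebra[OF X refl] and G = sigma_gen_subalgebra[OF ZX refl]
  have comp: "(\<lambda>\<omega>. g (Z \<omega>, X \<omega>)) \<in> borel_measurable ?G" if "g \<in> borel_measurable borel"
    for g :: "'c \<times> 'd \<Rightarrow> 'e::topological_space"
    using measurable_sigma_gen that by (rule measurable_compose)
  have XG: "X \<in> borel_measurable ?G"
    using comp[of snd] by (simp add: borel_prod[symmetric])
  have ZG: "Z \<in> borel_measurable ?G"
    using comp[of fst] by (simp add: borel_prod[symmetric])
  have FG: "subalgebra ?G ?F" by (rule sigma_gen_subalgebra[OF XG]) simp
  interpret F: sigma_finite_subalgebra M ?F using F by (rule sigma_finite_subalgebraI)
  interpret G: sigma_finite_subalgebra M ?G using G by (rule sigma_finite_subalgebraI)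
  have UV: "?UV A B = (\<lambda>\<omega>. ?V B \<omega> * ?U A \<omega>)" for A B
    by (auto simp: indicator_def)
  have U_meas[measurable]: "?U A \<in> borel_measurable M" if [measurable]: "A \<in> sets borel" for A
    by measurable
  have V_meas[measurable]: "?V B \<in> borel_measurable M" if [measurable]: "B \<in> sets borel" for B
    by measurable
  have U_bnd: "\<bar>?U A \<omega>\<bar> \<le> 1" and V_bnd: "\<bar>?V B \<omega>\<bar> \<le> 1" for A B \<omega>
    by (auto simp: indicator_def)
  have bnd_mult: "integrable M (\<lambda>\<omega>. u \<omega> * v \<omega>)"
    if [measurable]: "u \<in> borel_measurable M" "v \<in> borel_measurable M"
      and "AE \<omega> in M. \<bar>u \<omega>\<bar> \<le> 1" "AE \<omega> in M. \<bar>v \<omega>\<bar> \<le> 1" for u v :: "'a \<Rightarrow> real"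
  proof (rule integrable_bounded[where c = 1])
    show "AE \<omega> in M. \<bar>u \<omega> * v \<omega>\<bar> \<le> 1"
      using that(3,4) by eventually_elim (auto simp: abs_mult intro!: mult_le_one)
  qed measurable
  have V_G: "?V B \<in> borel_measurable ?G" if "B \<in> sets borel" for B
  proof -
    have "{\<omega>\<in>space M. Z \<omega> \<in> B} = Z -` B \<inter> space ?G" by auto
    then show ?thesis using measurable_sets[OF ZG that] by simp
  qed
  show ?thesis
  proof
    assume law: "same_cond_law M ?F ?G Y"
    show "cond_indep M Y Z X"
      unfolding cond_indep_def cond_probability_def cond_expectation_def
    proof (intro ballI)
      fix A :: "'b set" and B :: "'c set"
      assume A[measurable]: "A \<in> sets borel" and B[measurable]: "B \<in> sets borel"
      have VU: "integrable M (\<lambda>\<omega>. ?V B \<omega> * ?U A \<omega>)"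
        by (rule bnd_mult) (auto simp: U_bnd V_bnd)
      have EU: "AE \<omega> in M. \<bar>real_cond_exp M ?F (?U A) \<omega>\<bar> \<le> 1"
        by (rule cond_exp_bounded[OF F _ U_bnd]) measurable
      have pull: "AE \<omega> in M. real_cond_exp M ?G (\<lambda>\<omega>. ?V B \<omega> * ?U A \<omega>) \<omega> = real_cond_exp M ?F (?U A) \<omega> * ?V B \<omega>"
        using G.real_cond_exp_mult[OF V_G[OF B] U_meas[OF A] VU] law[unfolded same_cond_law_def, THEN bspec, OF A]
        by eventually_elim (simp add: mult.commute)
      have "AE \<omega> in M. real_cond_exp M ?F (real_cond_exp M ?G (\<lambda>\<omega>. ?V B \<omega> * ?U A \<omega>)) \<omega>
          = real_cond_exp M ?F (\<lambda>\<omega>. real_cond_exp M ?F (?U A) \<omega> * ?V B \<omega>) \<omega>"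
        by (rule F.real_cond_exp_cong[OF pull]) measurable
      moreover have "AE \<omega> in M. real_cond_exp M ?F (\<lambda>\<omega>. real_cond_exp M ?F (?U A) \<omega> * ?V B \<omega>) \<omega>
          = real_cond_exp M ?F (?U A) \<omega> * real_cond_exp M ?F (?V B) \<omega>"
        by (rule F.real_cond_exp_mult) (auto intro!: bnd_mult EU simp: V_bnd)
      ultimately show "AE \<omega> in M. real_cond_exp M ?F (?UV A B) \<omega>
          = real_cond_exp M ?F (?U A) \<omega> * real_cond_exp M ?F (?V B) \<omega>"
        using F.real_cond_exp_nested_subalg[OF G FG VU] unfolding UV by eventually_elim simp
    qed
  next
    assume indep: "cond_indep M Y Z X"
    show "same_cond_law M ?F ?G Y"
      unfolding same_cond_law_def
    proof
      fix A :: "'b set" assume A[measurable]: "A \<in> sets borel"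
      let ?q = "real_cond_exp M ?F (?U A)"
      have q_bnd: "AE \<omega> in M. \<bar>?q \<omega>\<bar> \<le> 1"
        by (rule cond_exp_bounded[OF F _ U_bnd]) measurable
      have intU: "integrable M (?U A)" by (rule integrable_bounded[OF _ AE_I2[OF U_bnd]]) measurable
      have intq: "integrable M ?q" by (rule integrable_bounded[OF _ q_bnd]) measurable
      have rect: "(LINT \<omega>:(\<lambda>\<omega>. (Z \<omega>, X \<omega>)) -` (B \<times> C) \<inter> space M|M. ?U A \<omega> - ?q \<omega>) = 0"
        if B[measurable]: "B \<in> sets borel" and C[measurable]: "C \<in> sets borel" for B C
      proof -
        let ?c = "\<lambda>\<omega>. indicat_real C (X \<omega>)"
        have c_F[measurable]: "?c \<in> borel_measurable ?F"
          using measurable_sigma_gen[of X M] by measurable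
        have c_bnd: "\<bar>?c \<omega>\<bar> \<le> 1" for \<omega> by (simp add: indicator_def)
        have cq_bnd: "AE \<omega> in M. \<bar>?c \<omega> * ?q \<omega>\<bar> \<le> 1"
          using q_bnd by eventually_elim (auto simp: abs_mult c_bnd intro!: mult_le_one)
        have VU_bnd: "\<bar>?V B \<omega> * ?U A \<omega>\<bar> \<le> 1" for \<omega> by (simp add: indicator_def)
        have [measurable]: "?c \<in> borel_measurable M" by measurable
        have c_VU: "integrable M (\<lambda>\<omega>. ?c \<omega> * (?V B \<omega> * ?U A \<omega>))"
          by (rule bnd_mult[OF _ _ AE_I2[OF c_bnd] AE_I2[OF VU_bnd]]) measurable
        have cq_V: "integrable M (\<lambda>\<omega>. (?c \<omega> * ?q \<omega>) * ?V B \<omega>)"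
          by (rule bnd_mult[OF _ _ cq_bnd AE_I2[OF V_bnd]]) measurable
        have "(\<integral>\<omega>. ?c \<omega> * (?V B \<omega> * ?U A \<omega>) \<partial>M)
            = (\<integral>\<omega>. ?c \<omega> * real_cond_exp M ?F (\<lambda>\<omega>. ?V B \<omega> * ?U A \<omega>) \<omega> \<partial>M)"
          by (rule F.real_cond_exp_intg(2)[OF c_VU c_F, symmetric]) measurable
        also have "\<dots> = (\<integral>\<omega>. (?c \<omega> * ?q \<omega>) * real_cond_exp M ?F (?V B) \<omega> \<partial>M)"
        proof (rule integral_cong_AE)
          have "AE \<omega> in M. real_cond_exp M ?F (\<lambda>\<omega>. ?V B \<omega> * ?U A \<omega>) \<omega> = ?q \<omega> * real_cond_exp M ?F (?V B) \<omega>"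
            using indep A B unfolding cond_indep_def cond_probability_def cond_expectation_def UV by blast
          then show "AE \<omega> in M. ?c \<omega> * real_cond_exp M ?F (\<lambda>\<omega>. ?V B \<omega> * ?U A \<omega>) \<omega>
              = (?c \<omega> * ?q \<omega>) * real_cond_exp M ?F (?V B) \<omega>"
            by eventually_elim simp
        qed measurable
        also have "\<dots> = (\<integral>\<omega>. (?c \<omega> * ?q \<omega>) * ?V B \<omega> \<partial>M)"
          by (rule F.real_cond_exp_intg(2)[OF cq_V]) measurable
        finally have eq: "(\<integral>\<omega>. ?c \<omega> * (?V B \<omega> * ?U A \<omega>) \<partial>M) = (\<integral>\<omega>. (?c \<omega> * ?q \<omega>) * ?V B \<omega> \<partial>M)" .
        have "(LINT \<omega>:(\<lambda>\<omega>. (Z \<omega>, X \<omega>)) -` (B \<times> C) \<inter> space M|M. ?U A \<omega> - ?q \<omega>)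
            = (\<integral>\<omega>. ?c \<omega> * (?V B \<omega> * ?U A \<omega>) - (?c \<omega> * ?q \<omega>) * ?V B \<omega> \<partial>M)"
          unfolding set_lebesgue_integral_def
          by (intro Bochner_Integration.integral_cong) (auto simp: indicator_def)
        also have "\<dots> = (\<integral>\<omega>. ?c \<omega> * (?V B \<omega> * ?U A \<omega>) \<partial>M) - (\<integral>\<omega>. (?c \<omega> * ?q \<omega>) * ?V B \<omega> \<partial>M)"
          by (rule Bochner_Integration.integral_diff[OF c_VU cq_V])
        finally show ?thesis using eq by simp
      qed
      have q_G: "?q \<in> borel_measurable ?G"
        by (rule measurable_from_subalg[OF FG]) simp
      have "AE \<omega> in M. real_cond_exp M ?G (?U A) \<omega> = ?q \<omega>"
      proof (rule G.real_cond_exp_charact[OF _ intU intq q_G])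
        fix S assume S: "S \<in> sets ?G"
        then obtain D where D: "D \<in> sets borel" "S = (\<lambda>\<omega>. (Z \<omega>, X \<omega>)) -` D \<inter> space M"
          by (auto simp: sets_sigma_gen)
        have SM: "S \<in> sets M" using S G by (auto simp: subalgebra_def)
        have si: "set_integrable M S u" if "integrable M u" for u :: "'a \<Rightarrow> real"
          using integrable_mult_indicator[OF SM that] by (simp add: set_integrable_def)
        have "(LINT \<omega>:S|M. ?U A \<omega> - ?q \<omega>) = 0"
          unfolding D(2)
          by (rule set_integral_eq_0_if_rectangles[OF Bochner_Integration.integrable_diff[OF intU intq] Z X rect D(1)])
        then show "(LINT \<omega>:S|M. ?U A \<omega>) = (LINT \<omega>:S|M. ?q \<omega>)"
          using set_integral_diff(2)[OF si[OF intU] si[OF intq]] by simp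
      qed
      then show "AE \<omega> in M. ?q \<omega> = real_cond_exp M ?G (?U A) \<omega>" by auto
    qed
  qed
qed

end

lemma ae_function_of_swap:
  fixes Z :: "'a \<Rightarrow> 'c::second_countable_topology" and X :: "'a \<Rightarrow> 'd::second_countable_topology"
  shows "ae_function_of M Y (\<lambda>\<omega>. (Z \<omega>, X \<omega>)) \<Longrightarrow> ae_function_of M Y (\<lambda>\<omega>. (X \<omega>, Z \<omega>))"
  unfolding ae_function_of_def
proof (elim bexE)
  fix f :: "'c \<times> 'd \<Rightarrow> 'b"
  assume f: "f \<in> borel_measurable borel" and eq: "AE \<omega> in M. Y \<omega> = f (Z \<omega>, X \<omega>)"
  have "prod.swap \<in> borel_measurable (borel :: ('d \<times> 'c) measure)"
    unfolding borel_prod[symmetric] prod.swap_def by measurable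
  then have "(\<lambda>p. f (prod.swap p)) \<in> borel_measurable borel" using f by (rule measurable_compose)
  then show "\<exists>g\<in>borel_measurable borel. AE \<omega> in M. Y \<omega> = g (X \<omega>, Z \<omega>)"
    using eq by (intro bexI[of _ "\<lambda>p. f (prod.swap p)"]) auto
qed

section \<open>The range of the statistic and its extreme values\<close>

theorem theorem2:
  fixes M :: "'a measure"
    and Y :: "'a \<Rightarrow> real^'dY"
    and X :: "'a \<Rightarrow> real^'dX"
    and Z :: "'a \<Rightarrow> real^'dZ"
  assumes "prob_space M"
    and "Y \<in> borel_measurable M"
    and "X \<in> borel_measurable M"
    and "Z \<in> borel_measurable M"
    and "\<not> ae_function_of M Y X"
  shows "T_AC_cond M Y X Z \<in> {0..1} \<and>
    (T_AC_cond M Y X Z = 0 \<longleftrightarrow> cond_indep M Y Z X) \<and>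
    (T_AC_cond M Y X Z = 1 \<longleftrightarrow> ae_function_of M Y (\<lambda>\<omega>. (X \<omega>, Z \<omega>)))"
proof -
  interpret prob_space M by fact
  note Y = \<open>Y \<in> borel_measurable M\<close> and X = \<open>X \<in> borel_measurable M\<close> and Z = \<open>Z \<in> borel_measurable M\<close>
  have ZX: "(\<lambda>\<omega>. (Z \<omega>, X \<omega>)) \<in> borel_measurable M"
    using Z X by (rule borel_measurable_Pair)
  let ?F = "sigma_gen M X" and ?G = "sigma_gen M (\<lambda>\<omega>. (Z \<omega>, X \<omega>))"
  let ?U = "\<lambda>y. indicat_real {\<omega>\<in>space M. y \<le> Y \<omega>}"
  have "(\<lambda>\<omega>. snd (Z \<omega>, X \<omega>)) \<in> borel_measurable ?G"
    using measurable_sigma_gen by (rule measurable_compose) (simp add: borel_prod[symmetric])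
  then have FG: "subalgebra ?G ?F" by (intro sigma_gen_subalgebra) auto
  have F: "subalgebra M ?F" and G: "subalgebra M ?G"
    using X ZX by (auto intro: sigma_gen_subalgebra)
  have MM: "subalgebra M M" by (simp add: subalgebra_def)
  have bnd: "\<bar>?U y x\<bar> \<le> 1" for y x by (simp add: indicator_def)
  note U = orthant_indicator_measurable[OF Y] bnd
  define gap where "gap F G = (\<integral>y. energy M G (?U y) - energy M F (?U y) \<partial>product_of_marginals M Y)" for F G
  note gap = integrated_energy_gap[OF Y, folded gap_def]
  have T: "T_AC_cond M Y X Z = gap ?F ?G / gap ?F M"
    unfolding T_AC_cond_def gap_def cond_probability_def cond_expectation_def
    by (simp only: expectation_cond_variance_cond_exp[OF X FG G U] expectation_cond_variance_energy[OF X U])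
  \<comment> \<open>The energy given \<open>(Z, X)\<close> lies between those given \<open>X\<close> and given everything, so the
    denominator exceeds the numerator by a gap of the same kind.\<close>
  have sum: "gap ?F M = gap ?F ?G + gap ?G M"
    unfolding gap_def using energy_orthant_integrable[OF Y] F G MM by simp
  have nonneg: "0 \<le> gap ?F ?G" "0 \<le> gap ?G M" "0 \<le> gap ?F M"
    using gap(1) FG F G MM by auto
  have "gap ?F M \<noteq> 0"
    using gap(2)[OF F MM] ae_function_of_iff_same_cond_law[OF Y X] assms(5) by simp
  with nonneg have pos: "0 < gap ?F M" by simp
  have "T_AC_cond M Y X Z \<in> {0..1}"
    unfolding T using nonneg pos sum by simp
  moreover have "T_AC_cond M Y X Z = 0 \<longleftrightarrow> cond_indep M Y Z X"
    unfolding T cond_indep_iff_same_cond_law[OF Y Z X] gap(2)[OF FG G, symmetric] using pos by simp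
  moreover have "T_AC_cond M Y X Z = 1 \<longleftrightarrow> gap ?G M = 0"
    unfolding T using pos sum by auto
  then have "T_AC_cond M Y X Z = 1 \<longleftrightarrow> ae_function_of M Y (\<lambda>\<omega>. (X \<omega>, Z \<omega>))"
    unfolding gap(2)[OF G MM] ae_function_of_iff_same_cond_law[OF Y ZX, symmetric]
    by (blast intro: ae_function_of_swap)
  ultimately show ?thesis by blast
qed

end
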